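(* (i) Let $\{a_n\}_{n\ge1}$ be complex numbers with $\sum_{n=1}^\infty|a_n|^2(\log n)^3<\infty$ and let $f_t(z)=\sum_{n=1}^\infty r_n(t)a_nz^n$ for $t\in[0,1]$, $z\in\mathbb D$. Then for almost every $t\in[0,1]$, $f_t\in BMOA_{\log}\cap H^\infty$. (ii) This is sharp: given any decreasing sequence of positive numbers $\{\delta_n\}_{n\ge1}$ with $\delta_n\to0$, there exists a sequence of positive numbers $\{a_n\}_{n\ge1}$ with $\sum_{n=1}^\infty a_n^2\delta_n(\log n)^3<\infty$ such that, for almost every $t$, the function $f_t(z)=\sum_{n=1}^\infty r_n(t)a_nz^n$ does not belong to $\mathcal B_{\log}$.
   Context: $\mathbb D$ is the open unit disc, $dA=\frac1\pi dx\,dy$, $H^\infty$ the bounded analytic functions. The Rademacher functions are $r_0(t)=1$ on $(0,1/2)$, $-1$ on $(1/2,1)$, $0$ at $t=0,1/2,1$, and $r_n(t)=r_0(2^nt)$ for $n\ge1$. For an arc $I\subset\partial\mathbb D$ of length $|I|$, $S(I)=\{re^{it}: e^{it}\in I,\ 1-\frac{|I|}{2\pi}\le r<1\}$. $BMOA_{\log}$ is the space of $g\in H^1$ for which there is $C>0$ with $\int_{S(I)}(1-|z|^2)|g'(z)|^2\,dA(z)\le C|I|(\log\frac{2}{|I|})^{-2}$ for every arc $I$. $\mathcal B_{\log}$ is the space of analytic $g$ with $\sup_z(1-|z|^2)|g'(z)|\log\frac{e}{1-|z|^2}<\infty$. *)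

theory Defs
  imports "HOL-Analysis.Analysis"
begin

text \<open>Rademacher functions: r_0 = 1 on (0,1/2), -1 on (1/2,1), 0 at 0,1/2,1,
  extended 1-periodically; r_n(t) = r_0(2^n t).  Equivalently r_n(t) = sgn(sin(2^(n+1) pi t)).\<close>
definition rademacher :: "nat \<Rightarrow> real \<Rightarrow> real" where
  "rademacher n t = sgn (sin (2 ^ (n + 1) * pi * t))"

definition rad_series :: "(nat \<Rightarrow> complex) \<Rightarrow> real \<Rightarrow> complex \<Rightarrow> complex" where
  "rad_series a t z = (\<Sum>n. complex_of_real (rademacher (Suc n) t) * a (Suc n) * z ^ Suc n)"

definition unit_disc :: "complex set" where
  "unit_disc = ball 0 1"

definition Hinf :: "(complex \<Rightarrow> complex) set" where
  "Hinf = {g. g holomorphic_on unit_disc \<and> bounded (g ` unit_disc)}"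

definition H1 :: "(complex \<Rightarrow> complex) set" where
  "H1 = {g. g holomorphic_on unit_disc \<and>
        (\<exists>M. \<forall>r. 0 \<le> r \<and> r < 1 \<longrightarrow>
           integral {0..2*pi} (\<lambda>s. cmod (g (complex_of_real r * cis s))) \<le> M)}"

text \<open>Carleson box S(I) of the arc I = {e^{is} : theta <= s <= theta + l}, |I| = l.\<close>
definition carleson_box :: "real \<Rightarrow> real \<Rightarrow> complex set" where
  "carleson_box \<theta> l = {complex_of_real r * cis s | r s.
        \<theta> \<le> s \<and> s \<le> \<theta> + l \<and> 1 - l / (2*pi) \<le> r \<and> r < 1}"

text \<open>BMOA_log.  dA = (1/pi) dx dy.  The condition
  int_{S(I)} ... dA <= C |I| (log(2/|I|))^(-2) is written in the equivalent multiplied form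
  (int_{S(I)} ... dA) * (log(2/|I|))^2 <= C |I| (avoids division by log 1 = 0 when |I| = 2).\<close>
definition BMOA_log :: "(complex \<Rightarrow> complex) set" where
  "BMOA_log = {g. g \<in> H1 \<and> (\<exists>C>0. \<forall>\<theta> l. 0 < l \<and> l \<le> 2*pi \<longrightarrow>
      (\<integral>\<^sup>+ z \<in> carleson_box \<theta> l.
          ennreal ((1 - (cmod z)\<^sup>2) * (cmod (deriv g z))\<^sup>2 / pi) \<partial>lborel)
        * ennreal ((ln (2 / l))\<^sup>2) \<le> ennreal (C * l))}"

definition Bloch_log :: "(complex \<Rightarrow> complex) set" where
  "Bloch_log = {g. g holomorphic_on unit_disc \<and>
      (\<exists>M. \<forall>z \<in> unit_disc. (1 - (cmod z)\<^sup>2) * cmod (deriv g z) * ln (exp 1 / (1 - (cmod z)\<^sup>2)) \<le> M)}"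

end

theory Submission
  imports Defs "HOL-Complex_Analysis.Complex_Analysis"
begin

text \<open>
  (i) Exponential moments of Rademacher sums are subgaussian. Cauchy's formula for \<open>exp (u * f\<^sub>t')\<close> turns
  the bound for the moments on the circle of radius \<open>1 - 2 ^ -(k+1)\<close> into a bound for the maximum on
  \<open>\<bar>z\<bar> \<le> 1 - 2 ^ -k\<close>, and summing over \<open>k\<close> gives, for almost every \<open>t\<close>, \<open>\<bar>f\<^sub>t'\<bar>\<^sup>2 \<le> C * k * V\<^sub>k\<close> on that disc,
  where \<open>V\<^sub>k = 1 + \<Sum> n\<^sup>2 * \<bar>a\<^sub>n\<bar>\<^sup>2 * (1 - 2 ^ -(k+1)) ^ (2n-2)\<close>. The hypothesis says
  \<open>\<Sum> k ^ 3 * 4 ^ -k * V\<^sub>k < \<infinity>\<close>, and such a pointwise bound for the derivative already implies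
  boundedness and the logarithmic Carleson condition.

  (ii) No probability is needed. The coefficients are concentrated on frequencies \<open>4 ^ m\<^sub>k + 4 ^ i\<close> with
  \<open>m\<^sub>k\<close> growing rapidly and \<open>m\<^sub>k\<^sub>-\<^sub>1 + 2 \<le> i < m\<^sub>k\<close>: about \<open>m\<^sub>k\<close> frequencies of the same size, with
  coefficients \<open>2 ^ k / m\<^sub>k\<^sup>2\<close>. For every choice of signs there is one angle at which
  all these terms of the derivative have real part bounded below by a fixed fraction of their modulus.
\<close>

section \<open>Exponential moments of Rademacher series\<close>

lemma rademacher_Suc: "rademacher (Suc n) t = rademacher n (2 * t)"
  by (simp add: rademacher_def mult_ac)

lemma rademacher_minus_one: "rademacher n (t - 1) = rademacher n t"
proof -
  have "2 ^ (n + 1) * pi * (t - 1) = 2 ^ (n + 1) * pi * t - of_int (2 ^ n) * (2 * pi)"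
    by (simp add: algebra_simps)
  moreover have "sin (x - of_int k * (2 * pi)) = sin x" for x :: real and k :: int
    using sin_int_2pin[of k] cos_int_2pin[of k] by (simp add: sin_diff mult_ac)
  ultimately show ?thesis
    unfolding rademacher_def by metis
qed

lemma rademacher_0_left: "0 < t \<Longrightarrow> t < 1/2 \<Longrightarrow> rademacher 0 t = 1"
  unfolding rademacher_def by (subst sgn_pos) (auto intro!: sin_gt_zero)

lemma rademacher_0_right: "1/2 < t \<Longrightarrow> t < 1 \<Longrightarrow> rademacher 0 t = -1"
  unfolding rademacher_def by (subst sgn_neg) (auto intro!: sin_lt_zero)

lemma abs_rademacher_le_1: "\<bar>rademacher n t\<bar> \<le> 1"
  by (simp add: rademacher_def sgn_if)

lemma borel_measurable_rademacher [measurable]: "rademacher n \<in> borel_measurable borel"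
  unfolding rademacher_def by measurable

text \<open>Compare Taylor coefficients: \<open>(2n)!\<close> is at least
  \<open>2 ^ n * n!\<close>.\<close>

lemma cosh_le_exp_half_square: "cosh x \<le> exp (x\<^sup>2 / 2)" for x :: real
proof -
  have 1: "(\<lambda>n. if even n then x ^ n /\<^sub>R fact n else 0) sums cosh x"
    using cosh_converges[of x] by simp
  have "(if even n then x ^ n /\<^sub>R fact n else 0) = 0" if "n \<notin> range (\<lambda>n. 2 * n)" for n :: nat
    using that by (metis evenE rangeI)
  then have "(\<lambda>n. (if even (2*n) then x ^ (2*n) /\<^sub>R fact (2*n) else 0)) sums cosh x"
    using 1 by (subst sums_mono_reindex) (simp_all add: strict_mono_def)
  then have 2: "(\<lambda>n. x ^ (2*n) / fact (2*n)) sums cosh x"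
    by (simp add: field_simps)
  have 3: "(\<lambda>n. (x\<^sup>2 / 2) ^ n / fact n) sums exp (x\<^sup>2 / 2)"
    using exp_converges[of "x\<^sup>2/2"] by (simp add: field_simps)
  have fact_le: "2 ^ n * fact n \<le> (fact (2 * n) :: real)" for n
  proof (induction n)
    case (Suc n)
    have "2 ^ Suc n * fact (Suc n) = (2 * real n + 2) * (2 ^ n * fact n)"
      by (simp add: algebra_simps)
    also have "\<dots> \<le> ((2 * real n + 2) * (2 * real n + 1)) * fact (2 * n)"
      by (intro mult_mono Suc.IH) (auto simp: algebra_simps)
    also have "\<dots> = fact (2 * Suc n)"
      by (simp add: algebra_simps)
    finally show ?case .
  qed simp
  have "x ^ (2*n) / fact (2*n) \<le> (x\<^sup>2 / 2) ^ n / fact n" for n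
  proof -
    have "x ^ (2*n) / fact (2*n) \<le> x ^ (2*n) / (2 ^ n * fact n)"
      by (intro divide_left_mono fact_le) auto
    also have "\<dots> = (x\<^sup>2 / 2) ^ n / fact n"
      by (simp add: power_mult power_divide)
    finally show ?thesis .
  qed
  then show ?thesis
    by (rule sums_le[OF _ 2 3])
qed

text \<open>Independence enters as self-similarity: \<open>rademacher 0\<close> is constant on each
  half of the interval, and the later functions are the earlier ones at \<open>2 * t\<close>. Hence
  a factor \<open>cosh (c 0)\<close> splits off and the same integral with shifted coefficients
  remains.\<close>

lemma nn_integral_exp_rademacher_le:
  fixes c :: "nat \<Rightarrow> real"
  shows "(\<integral>\<^sup>+ t. ennreal (exp (\<Sum>i<n. c i * rademacher i t)) * indicator {0<..<1} t \<partial>lborel)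
     \<le> ennreal (exp ((\<Sum>i<n. (c i)\<^sup>2) / 2))"
proof (induction n arbitrary: c)
  case 0
  then show ?case by simp
next
  case (Suc n)
  \<comment> \<open>The indicator is part of \<open>G\<close>, so \<open>G (2 * t)\<close> and
    \<open>G (2 * t - 1)\<close> live on the left and on the right half.\<close>
  define G where "G t = ennreal (exp (\<Sum>i<n. c (Suc i) * rademacher i t)) * indicator {0<..<1} t" for t
  have G_meas [measurable]: "G \<in> borel_measurable borel"
    unfolding G_def by simp
  have half: "(\<integral>\<^sup>+ t. G (2 * t - b) \<partial>lborel) = ennreal (1/2) * (\<integral>\<^sup>+ t. G t \<partial>lborel)" for b
  proof -
    have "(\<integral>\<^sup>+ t. G t \<partial>lborel) = ennreal 2 * (\<integral>\<^sup>+ t. G (2 * t - b) \<partial>lborel)"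
      using nn_integral_real_affine[of G 2 "-b"] by simp
    moreover have "ennreal (1/2) * ennreal 2 = 1"
      by (subst ennreal_mult[symmetric]) auto
    ultimately show ?thesis
      by (metis mult.assoc mult_1)
  qed
  have "(\<integral>\<^sup>+ t. ennreal (exp (\<Sum>i<Suc n. c i * rademacher i t)) * indicator {0<..<1} t \<partial>lborel)
     = (\<integral>\<^sup>+ t. ennreal (exp (c 0)) * G (2 * t - 0) + ennreal (exp (- c 0)) * G (2 * t - 1) \<partial>lborel)"
  \<comment> \<open>The midpoint, where \<open>rademacher 0\<close> vanishes, is discarded as a null
    set.\<close>
  proof (rule nn_integral_cong_AE, rule AE_mp[OF AE_lborel_singleton[of "1/2"]], rule AE_I2, rule impI)
    fix t :: real assume t: "t \<noteq> 1/2"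
    have sum: "(\<Sum>i<Suc n. c i * rademacher i t)
        = c 0 * rademacher 0 t + (\<Sum>i<n. c (Suc i) * rademacher i (2 * t))"
      by (simp add: sum.lessThan_Suc_shift rademacher_Suc del: sum.lessThan_Suc)
    consider "t \<le> 0 \<or> t \<ge> 1" | "0 < t" "t < 1/2" | "1/2 < t" "t < 1" using t by linarith
    then show "ennreal (exp (\<Sum>i<Suc n. c i * rademacher i t)) * indicator {0<..<1} t
      = ennreal (exp (c 0)) * G (2 * t - 0) + ennreal (exp (- c 0)) * G (2 * t - 1)"
    proof cases
      case 1
      then show ?thesis by (auto simp: G_def indicator_def)
    next
      case 2
      then show ?thesis
        unfolding sum G_def rademacher_0_left[OF 2]
        by (simp add: exp_add[symmetric] ennreal_mult[symmetric] indicator_def)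
    next
      case 3
      then show ?thesis
        unfolding sum G_def rademacher_0_right[OF 3] rademacher_minus_one
        by (simp add: exp_add[symmetric] ennreal_mult[symmetric] indicator_def)
    qed
  qed
  also have "\<dots> = (ennreal (exp (c 0)) + ennreal (exp (- c 0))) * (ennreal (1/2) * (\<integral>\<^sup>+ t. G t \<partial>lborel))"
    by (subst nn_integral_add, simp, simp, subst (1 2) nn_integral_cmult, simp, simp)
      (simp only: half distrib_right)
  also have "\<dots> = ennreal (cosh (c 0)) * (\<integral>\<^sup>+ t. G t \<partial>lborel)"
  proof -
    have "ennreal (cosh (c 0)) = (ennreal (exp (c 0)) + ennreal (exp (- c 0))) * ennreal (1/2)"
      by (simp add: cosh_def ennreal_plus[symmetric] ennreal_mult[symmetric] field_simps
          del: ennreal_plus ennreal_half)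
    then show ?thesis
      by (simp only: mult.assoc)
  qed
  also have "\<dots> \<le> ennreal (exp ((c 0)\<^sup>2 / 2)) * ennreal (exp ((\<Sum>i<n. (c (Suc i))\<^sup>2) / 2))"
    unfolding G_def by (intro mult_mono Suc.IH ennreal_leI cosh_le_exp_half_square) auto
  also have "\<dots> = ennreal (exp ((\<Sum>i<Suc n. (c i)\<^sup>2) / 2))"
    by (simp add: ennreal_mult[symmetric] exp_add[symmetric] sum.lessThan_Suc_shift add_divide_distrib
      del: sum.lessThan_Suc)
  finally show ?case .
qed

text \<open>Fatou's lemma for the partial sums; absolute summability makes them converge
  pointwise.\<close>

lemma nn_integral_exp_rademacher_series_le:
  fixes c :: "nat \<Rightarrow> real"
  assumes "summable (\<lambda>n. \<bar>c n\<bar>)" "summable (\<lambda>n. (c n)\<^sup>2)"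
  shows "(\<integral>\<^sup>+ t. ennreal (exp (\<Sum>n. c n * rademacher (Suc n) t)) * indicator {0<..<1} t \<partial>lborel)
     \<le> ennreal (exp ((\<Sum>n. (c n)\<^sup>2) / 2))"
proof -
  define g where "g n t = ennreal (exp (\<Sum>i<n. c i * rademacher (Suc i) t)) * indicator {0<..<1} t" for n t
  have [measurable]: "g n \<in> borel_measurable borel" for n
    unfolding g_def by measurable
  have lim: "(\<lambda>n. g n t) \<longlonglongrightarrow> ennreal (exp (\<Sum>n. c n * rademacher (Suc n) t)) * indicator {0<..<1} t" for t
  proof -
    have "summable (\<lambda>n. c n * rademacher (Suc n) t)"
      by (rule summable_comparison_test'[OF assms(1), of 0])
        (use abs_rademacher_le_1 in \<open>auto simp: abs_mult intro: mult_left_le\<close>)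
    then have *: "(\<lambda>n. \<Sum>i<n. c i * rademacher (Suc i) t) \<longlonglongrightarrow> (\<Sum>n. c n * rademacher (Suc n) t)"
      by (rule summable_LIMSEQ)
    have "(\<lambda>n. ennreal (exp (\<Sum>i<n. c i * rademacher (Suc i) t))) \<longlonglongrightarrow> ennreal (exp (\<Sum>n. c n * rademacher (Suc n) t))"
      by (intro tendsto_ennrealI tendsto_exp *)
    then show ?thesis
      unfolding g_def by (cases "t \<in> {0<..<1}") auto
  qed
  have bound: "(\<integral>\<^sup>+ t. g n t \<partial>lborel) \<le> ennreal (exp ((\<Sum>n. (c n)\<^sup>2) / 2))" for n
  proof -
    \<comment> \<open>The series starts with \<open>rademacher 1\<close>, the finite bound with
      \<open>rademacher 0\<close>: \<open>d\<close> puts a zero coefficient in front.\<close>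
    define d where "d i = (if i = 0 then 0 else c (i - 1))" for i
    have "(\<integral>\<^sup>+ t. g n t \<partial>lborel) = (\<integral>\<^sup>+ t. ennreal (exp (\<Sum>i<Suc n. d i * rademacher i t)) * indicator {0<..<1} t \<partial>lborel)"
      unfolding g_def by (simp add: d_def sum.lessThan_Suc_shift del: sum.lessThan_Suc)
    also have "\<dots> \<le> ennreal (exp ((\<Sum>i<Suc n. (d i)\<^sup>2) / 2))"
      by (rule nn_integral_exp_rademacher_le)
    also have "(\<Sum>i<Suc n. (d i)\<^sup>2) = (\<Sum>i<n. (c i)\<^sup>2)"
      by (simp add: d_def sum.lessThan_Suc_shift del: sum.lessThan_Suc)
    also have "ennreal (exp ((\<Sum>i<n. (c i)\<^sup>2) / 2)) \<le> ennreal (exp ((\<Sum>n. (c n)\<^sup>2) / 2))"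
      using sum_le_suminf[OF assms(2), of "{..<n}"] by (auto intro!: ennreal_leI)
    finally show ?thesis .
  qed
  have "(\<integral>\<^sup>+ t. ennreal (exp (\<Sum>n. c n * rademacher (Suc n) t)) * indicator {0<..<1} t \<partial>lborel)
    = (\<integral>\<^sup>+ t. liminf (\<lambda>n. g n t) \<partial>lborel)"
    by (intro nn_integral_cong) (rule lim_imp_Liminf[OF _ lim, symmetric], simp)
  also have "\<dots> \<le> liminf (\<lambda>n. \<integral>\<^sup>+ t. g n t \<partial>lborel)"
    by (rule nn_integral_liminf) simp
  also have "\<dots> \<le> ennreal (exp ((\<Sum>n. (c n)\<^sup>2) / 2))"
    by (rule Liminf_le) (auto intro!: always_eventually bound)
  finally show ?thesis .
qed

section \<open>The derivative of a Rademacher power series\<close>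

text \<open>The termwise derivative of \<open>rad_series a t\<close>. Written as a series it is a
  Rademacher sum for each fixed \<open>z\<close>, and its measurability in \<open>t\<close> is
  visible.\<close>

definition rad_deriv :: "(nat \<Rightarrow> complex) \<Rightarrow> real \<Rightarrow> complex \<Rightarrow> complex" where
  "rad_deriv a t z = (\<Sum>n. complex_of_real (rademacher (Suc n) t) * (of_nat (Suc n) * a (Suc n) * z ^ n))"

lemma summable_Suc_mult_power:
  assumes "0 \<le> r" "r < 1"
  shows "summable (\<lambda>n. real (Suc n) * r ^ n)"
  using assms geometric_deriv_sums[of r] by (auto simp: sums_iff)

lemma summable_rad_deriv:
  assumes "\<forall>n. cmod (a (Suc n)) \<le> B" "cmod z < 1"
  shows "summable (\<lambda>n. cmod (of_nat (Suc n) * a (Suc n) * z ^ n))"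
proof (rule summable_comparison_test'[of "\<lambda>n. B * (real (Suc n) * cmod z ^ n)" 0])
  show "summable (\<lambda>n. B * (real (Suc n) * cmod z ^ n))"
    by (intro summable_mult summable_Suc_mult_power) (use assms in auto)
  fix n
  show "norm (cmod (of_nat (Suc n) * a (Suc n) * z ^ n)) \<le> B * (real (Suc n) * cmod z ^ n)"
    using mult_right_mono[OF assms(1)[rule_format, of n], of "real (Suc n) * cmod z ^ n"]
    by (simp add: norm_mult norm_power mult_ac del: of_nat_Suc)
qed

lemma summable_rad_deriv_sign:
  assumes "\<forall>n. cmod (a (Suc n)) \<le> B" "cmod z < 1"
  shows "summable (\<lambda>n. complex_of_real (rademacher (Suc n) t) * (of_nat (Suc n) * a (Suc n) * z ^ n))"
proof (rule summable_comparison_test'[OF summable_rad_deriv[OF assms]])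
  fix n
  show "norm (complex_of_real (rademacher (Suc n) t) * (of_nat (Suc n) * a (Suc n) * z ^ n))
     \<le> cmod (of_nat (Suc n) * a (Suc n) * z ^ n)"
    unfolding norm_mult[of "complex_of_real _"] using abs_rademacher_le_1[of "Suc n" t]
    by (intro mult_left_le_one_le) auto
qed

lemma has_field_derivative_rad_series:
  assumes a: "\<forall>n. cmod (a (Suc n)) \<le> B" and z: "cmod z < 1"
  shows "(rad_series a t has_field_derivative rad_deriv a t z) (at z)"
proof -
  \<comment> \<open>\<open>a 0\<close> is arbitrary, while \<open>rad_series\<close> has no constant
    term.\<close>
  define c where "c n = (if n = 0 then 0 else complex_of_real (rademacher n t) * a n)" for n
  define K where "K = (1 + cmod z) / 2"
  have K: "cmod z < K" "K < 1" "0 < K"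
    using z by (auto simp: K_def add_pos_nonneg)
  have cn: "cmod (c n) \<le> \<bar>B\<bar>" for n
  proof (cases n)
    case (Suc m)
    have "cmod (c n) = \<bar>rademacher n t\<bar> * cmod (a (Suc m))"
      by (simp add: c_def Suc norm_mult)
    also have "\<dots> \<le> 1 * cmod (a (Suc m))"
      by (intro mult_right_mono abs_rademacher_le_1) auto
    finally show ?thesis using a[rule_format, of m] by simp
  qed (simp add: c_def)
  have sm: "summable (\<lambda>n. c n * complex_of_real x ^ n)" if "0 \<le> x" "x < 1" for x :: real
  proof (rule summable_comparison_test'[of "\<lambda>n. \<bar>B\<bar> * x ^ n" 0])
    show "summable (\<lambda>n. \<bar>B\<bar> * x ^ n)"
      using that by (intro summable_mult summable_geometric) auto
    show "norm (c n * complex_of_real x ^ n) \<le> \<bar>B\<bar> * x ^ n" for n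
      using that cn[of n] by (auto simp: norm_mult norm_power intro!: mult_right_mono)
  qed
  have eq: "rad_series a t w = (\<Sum>n. c n * w ^ n)" if "cmod w < 1" for w
  proof -
    have lt: "cmod w < cmod (complex_of_real ((1 + cmod w) / 2))"
      unfolding norm_of_real using that by simp
    have "summable (\<lambda>n. c n * w ^ n)"
      by (rule powser_inside[OF sm lt]) (use that in auto)
    then show ?thesis
      using suminf_split_head[of "\<lambda>n. c n * w ^ n"] by (simp add: rad_series_def c_def)
  qed
  have "((\<lambda>w. \<Sum>n. c n * w ^ n) has_field_derivative (\<Sum>n. diffs c n * z ^ n)) (at z)"
    by (rule termdiffs_strong[of _ "complex_of_real K"]) (use K sm[of K] in auto)
  moreover have "(\<Sum>n. diffs c n * z ^ n) = rad_deriv a t z"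
    by (simp add: rad_deriv_def diffs_def c_def mult_ac)
  ultimately have "((\<lambda>w. \<Sum>n. c n * w ^ n) has_field_derivative rad_deriv a t z) (at z)"
    by simp
  then show ?thesis
    by (rule has_field_derivative_transform_within_open[of _ _ _ "ball 0 1"])
      (use z eq in auto)
qed

lemma holomorphic_rad_series:
  assumes "\<forall>n. cmod (a (Suc n)) \<le> B"
  shows "rad_series a t holomorphic_on ball 0 1"
  unfolding holomorphic_on_open[OF open_ball]
  using has_field_derivative_rad_series[OF assms] by (metis dist_0_norm mem_ball)

lemma deriv_rad_series:
  assumes "\<forall>n. cmod (a (Suc n)) \<le> B" "cmod z < 1"
  shows "deriv (rad_series a t) z = rad_deriv a t z"
  by (intro DERIV_imp_deriv has_field_derivative_rad_series[OF assms])

lemma holomorphic_rad_deriv: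
  assumes "\<forall>n. cmod (a (Suc n)) \<le> B"
  shows "rad_deriv a t holomorphic_on ball 0 1"
proof -
  have "deriv (rad_series a t) holomorphic_on ball 0 1"
    by (intro holomorphic_deriv holomorphic_rad_series[OF assms]) auto
  then show ?thesis
    by (rule holomorphic_transform) (simp add: deriv_rad_series[OF assms])
qed

section \<open>From exponential moments to almost sure bounds on discs\<close>

text \<open>The function \<open>exp (G w)\<close> is holomorphic with modulus
  \<open>exp (Re (G w))\<close>. Cauchy's formula on the circle of radius \<open>q\<close> bounds it
  at \<open>z\<close> by its mean over the circle; the kernel costs \<open>q / (q - \<rho>)\<close>
  because \<open>z\<close> stays at distance at least \<open>q - \<rho>\<close> from the
  circle.\<close>

lemma cmod_exp_le_circle_mean:
  assumes G: "G holomorphic_on ball 0 1" and q: "q < 1" and z: "cmod z \<le> \<rho>" "\<rho> < q"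
  shows "ennreal (exp (Re (G z)))
    \<le> ennreal (q / (q - \<rho>)) *
       (\<integral>\<^sup>+ x. ennreal (exp (Re (G (of_real q * cis (2 * pi * x))))) * indicator {0<..<1} x \<partial>lborel)"
proof -
  have \<rho>: "0 \<le> \<rho>" and q0: "0 < q"
    using norm_ge_zero[of z] z by linarith+
  define h where "h x = exp (Re (G (of_real q * cis (2 * pi * x))))" for x
  have circ: "circlepath 0 q x = of_real q * cis (2 * pi * x)" for x
    by (simp add: circlepath cis_conv_exp mult_ac)
  have cont_G: "continuous_on (ball 0 1) G"
    using G holomorphic_on_imp_continuous_on by blast
  have cont_h: "continuous_on UNIV h"
    unfolding h_def
    by (intro continuous_intros continuous_on_compose2[OF cont_G]) (use q q0 in \<open>auto simp: norm_mult\<close>)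
  have h_pos: "0 \<le> h x" for x
    by (simp add: h_def)
  have h_meas: "h \<in> borel_measurable borel"
    by (intro borel_measurable_continuous_onI cont_h)
  have "(\<lambda>w. exp (G w)) holomorphic_on cball 0 q"
    by (intro holomorphic_intros holomorphic_on_subset[OF G]) (use q in auto)
  then have "((\<lambda>w. exp (G w) / (w - z)) has_contour_integral (2 * of_real pi * \<i> * exp (G z))) (circlepath 0 q)"
    by (rule Cauchy_integral_circlepath_simple) (use z in auto)
  then have hi: "((\<lambda>x. exp (G (circlepath 0 q x)) / (circlepath 0 q x - z) *
        vector_derivative (circlepath 0 q) (at x)) has_integral (2 * of_real pi * \<i> * exp (G z))) {0..1}"
    by (simp add: has_contour_integral)
  have h_int: "h integrable_on {0..1}"
    by (intro integrable_continuous_interval continuous_on_subset[OF cont_h]) auto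
  have "cmod (2 * of_real pi * \<i> * exp (G z)) \<le> integral {0..1} (\<lambda>x. (2 * pi * (q / (q - \<rho>))) * h x)"
    unfolding integral_unique[OF hi, symmetric]
  proof (rule integral_norm_bound_integral)
    show "(\<lambda>x. exp (G (circlepath 0 q x)) / (circlepath 0 q x - z) *
        vector_derivative (circlepath 0 q) (at x)) integrable_on {0..1}"
      using hi by blast
    show "(\<lambda>x. (2 * pi * (q / (q - \<rho>))) * h x) integrable_on {0..1}"
      using integrable_on_cmult_left[OF h_int, of "2 * pi * (q / (q - \<rho>))"] by (simp only: of_real_eq_id id_apply)
    fix x :: real
    have "q - \<rho> \<le> cmod (circlepath 0 q x - z)"
      using norm_triangle_ineq2[of "circlepath 0 q x" z] z q0 by (simp add: circ norm_mult)
    then have "cmod (exp (G (circlepath 0 q x))) * (2 * pi * q) / cmod (circlepath 0 q x - z)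
       \<le> cmod (exp (G (circlepath 0 q x))) * (2 * pi * q) / (q - \<rho>)"
      using z q0 by (intro divide_left_mono mult_nonneg_nonneg mult_pos_pos) auto
    then show "cmod (exp (G (circlepath 0 q x)) / (circlepath 0 q x - z) *
        vector_derivative (circlepath 0 q) (at x)) \<le> (2 * pi * (q / (q - \<rho>))) * h x"
      using q0 by (simp add: vector_derivative_circlepath norm_mult norm_divide h_def circ mult_ac)
  qed
  also have "\<dots> = 2 * pi * (q / (q - \<rho>) * integral {0..1} h)"
    by (simp add: mult.assoc)
  also have "cmod (2 * of_real pi * \<i> * exp (G z)) = 2 * pi * exp (Re (G z))"
    by (simp add: norm_mult)
  finally have le: "exp (Re (G z)) \<le> q / (q - \<rho>) * integral {0..1} h"
    by (subst (asm) mult_le_cancel_left_pos) auto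
  \<comment> \<open>The mean is rewritten as a Lebesgue integral, the form in which it can be
    exchanged with the integral over \<open>t\<close>.\<close>
  have "ennreal (integral {0..1} h) = (\<integral>\<^sup>+ x. ennreal (h x) * indicator {0<..<1} x \<partial>lborel)"
  proof -
    have "(h has_integral integral {0..1} h) {0<..<1}"
      using integrable_integral[OF h_int] by (simp add: has_integral_Icc_iff_Ioo)
    moreover have "(\<lambda>x. h x * indicator {0<..<1} x) = (\<lambda>x. if x \<in> {0<..<1} then h x else 0)"
      by (auto simp: indicator_def)
    ultimately have "((\<lambda>x. h x * indicator {0<..<1} x) has_integral integral {0..1} h) UNIV"
      by (simp only: has_integral_restrict_UNIV)
    then have "(\<integral>\<^sup>+ x. ennreal (h x * indicator {0<..<1} x) \<partial>lborel) = ennreal (integral {0..1} h)"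
      by (intro nn_integral_has_integral_lborel) (use h_meas h_pos in auto)
    then show ?thesis
      using h_pos by (simp add: ennreal_mult' ennreal_indicator[symmetric] del: ennreal_indicator)
  qed
  moreover have "ennreal (q / (q - \<rho>) * integral {0..1} h) = ennreal (q / (q - \<rho>)) * ennreal (integral {0..1} h)"
    using q0 z by (intro ennreal_mult) (auto intro!: integral_nonneg h_int h_pos)
  ultimately show ?thesis
    using ennreal_leI[OF le] by (simp add: h_def)
qed

lemma measurable_rad_deriv_circle [measurable]:
  "(\<lambda>p. rad_deriv a (fst p) (of_real q * cis (2 * pi * snd p))) \<in> borel_measurable (borel \<Otimes>\<^sub>M borel)"
proof -
  have "cis \<in> borel_measurable borel"
    by (intro borel_measurable_continuous_onI continuous_intros)
  then show ?thesis
    unfolding rad_deriv_def by measurable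
qed

text \<open>The variance of \<open>rad_deriv a t z\<close> under random signs, at any point
  \<open>z\<close> of modulus \<open>q\<close>.\<close>

definition rad_energy :: "(nat \<Rightarrow> complex) \<Rightarrow> real \<Rightarrow> real" where
  "rad_energy a q = (\<Sum>n. (cmod (of_nat (Suc n) * a (Suc n) * of_real q ^ n))\<^sup>2)"

lemma summable_rad_energy:
  assumes "\<forall>n. cmod (a (Suc n)) \<le> B" "cmod z < 1"
  shows "summable (\<lambda>n. (cmod (of_nat (Suc n) * a (Suc n) * z ^ n))\<^sup>2)"
proof -
  have s: "summable (\<lambda>n. cmod (of_nat (Suc n) * a (Suc n) * z ^ n))"
    by (rule summable_rad_deriv[OF assms])
  then have "eventually (\<lambda>n. cmod (of_nat (Suc n) * a (Suc n) * z ^ n) < 1) sequentially"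
    by (intro order_tendstoD(2)[OF summable_LIMSEQ_zero]) auto
  then have "eventually (\<lambda>n. norm ((cmod (of_nat (Suc n) * a (Suc n) * z ^ n))\<^sup>2)
      \<le> cmod (of_nat (Suc n) * a (Suc n) * z ^ n)) sequentially"
    by eventually_elim (auto simp: power2_eq_square intro: mult_left_le)
  then show ?thesis
    by (rule summable_comparison_test_ev[OF _ s])
qed

text \<open>For fixed \<open>z\<close> the exponent is a real Rademacher sum whose coefficients are
  at most \<open>cmod u\<close> times the moduli of the derivative's terms. A complex
  \<open>u\<close> lets one bound serve real and imaginary parts of either sign.\<close>

lemma nn_integral_exp_rad_deriv_le:
  assumes a: "\<forall>n. cmod (a (Suc n)) \<le> B" and z: "cmod z < 1"
  shows "(\<integral>\<^sup>+ t. ennreal (exp (Re (u * rad_deriv a t z))) * indicator {0<..<1} t \<partial>lborel)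
     \<le> ennreal (exp ((cmod u)\<^sup>2 * rad_energy a (cmod z) / 2))"
proof -
  define b where "b n = of_nat (Suc n) * a (Suc n) * z ^ n" for n
  define c where "c n = Re (u * b n)" for n
  have c_le: "\<bar>c n\<bar> \<le> cmod u * cmod (b n)" for n
    unfolding c_def norm_mult[symmetric] by (rule abs_Re_le_cmod)
  have c2_le: "(c n)\<^sup>2 \<le> (cmod u)\<^sup>2 * (cmod (b n))\<^sup>2" for n
    using power_mono[OF c_le[of n], of 2] by (simp add: power_mult_distrib)
  have s1: "summable (\<lambda>n. cmod u * cmod (b n))"
    unfolding b_def by (intro summable_mult summable_rad_deriv[OF a z])
  have s2: "summable (\<lambda>n. (cmod u)\<^sup>2 * (cmod (b n))\<^sup>2)"
    unfolding b_def by (intro summable_mult summable_rad_energy[OF a z])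
  have sc: "summable (\<lambda>n. \<bar>c n\<bar>)"
    by (rule summable_comparison_test'[OF s1]) (use c_le in auto)
  have sc2: "summable (\<lambda>n. (c n)\<^sup>2)"
    by (rule summable_comparison_test'[OF s2]) (use c2_le in auto)
  have "Re (u * rad_deriv a t z) = (\<Sum>n. c n * rademacher (Suc n) t)" for t
  proof -
    have s: "summable (\<lambda>n. complex_of_real (rademacher (Suc n) t) * b n)"
      unfolding b_def by (rule summable_rad_deriv_sign[OF a z])
    have "u * rad_deriv a t z = (\<Sum>n. u * (complex_of_real (rademacher (Suc n) t) * b n))"
      unfolding rad_deriv_def b_def[symmetric] by (rule suminf_mult[OF s, symmetric])
    also have "Re \<dots> = (\<Sum>n. Re (u * (complex_of_real (rademacher (Suc n) t) * b n)))"
      by (rule Re_suminf[OF summable_mult[OF s]])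
    also have "\<dots> = (\<Sum>n. c n * rademacher (Suc n) t)"
      by (simp add: c_def algebra_simps)
    finally show ?thesis .
  qed
  then have "(\<integral>\<^sup>+ t. ennreal (exp (Re (u * rad_deriv a t z))) * indicator {0<..<1} t \<partial>lborel)
     \<le> ennreal (exp ((\<Sum>n. (c n)\<^sup>2) / 2))"
    using nn_integral_exp_rademacher_series_le[OF sc sc2] by simp
  also have "(\<Sum>n. (c n)\<^sup>2) \<le> (\<Sum>n. (cmod u)\<^sup>2 * (cmod (b n))\<^sup>2)"
    by (intro suminf_le c2_le sc2 s2)
  then have "ennreal (exp ((\<Sum>n. (c n)\<^sup>2) / 2)) \<le> ennreal (exp ((\<Sum>n. (cmod u)\<^sup>2 * (cmod (b n))\<^sup>2) / 2))"
    by (intro ennreal_leI) simp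
  also have "(\<Sum>n. (cmod u)\<^sup>2 * (cmod (b n))\<^sup>2) = (cmod u)\<^sup>2 * (\<Sum>n. (cmod (b n))\<^sup>2)"
    unfolding b_def by (rule suminf_mult[OF summable_rad_energy[OF a z]])
  also have "(\<Sum>n. (cmod (b n))\<^sup>2) = rad_energy a (cmod z)"
    by (simp add: rad_energy_def b_def norm_mult norm_power)
  finally show ?thesis .
qed

text \<open>The hypothesis on \<open>u\<close> bounds the moments on the circle of radius
  \<open>1 - 1 / 2 ^ (k + 1)\<close> by \<open>exp k\<close>. A circle mean controls the whole
  smaller disc at once, so a weighted sum of these means, finite almost everywhere because its
  integral is finite, bounds all \<open>k\<close> and \<open>z\<close> together.\<close>

lemma AE_exp_rad_deriv_bound:
  assumes a: "\<forall>n. cmod (a (Suc n)) \<le> B"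
    and u: "\<And>k. (cmod (u k))\<^sup>2 * rad_energy a (1 - 1 / 2 ^ (k + 1)) \<le> 2 * real k"
  shows "AE t in lborel. t \<in> {0<..<1} \<longrightarrow> (\<exists>T\<ge>1. \<forall>k z. cmod z \<le> 1 - 1 / 2 ^ k \<longrightarrow>
      exp (Re (u k * rad_deriv a t z)) \<le> T * 8 ^ k)"
proof -
  define q where "q k = 1 - 1 / (2::real) ^ (k + 1)" for k
  define \<rho> where "\<rho> k = 1 - 1 / (2::real) ^ k" for k
  have q: "0 \<le> q k" "q k < 1" "\<rho> k < q k" "q k / (q k - \<rho> k) \<le> 2 ^ (k + 1)" for k
  proof -
    have "q k - \<rho> k = 1 / 2 ^ (k + 1)" by (simp add: q_def \<rho>_def)
    then have "q k / (q k - \<rho> k) = q k * 2 ^ (k + 1)" by simp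
    moreover have "q k * 2 ^ (k + 1) \<le> 1 * 2 ^ (k + 1)"
      by (intro mult_right_mono) (auto simp: q_def)
    ultimately show "q k / (q k - \<rho> k) \<le> 2 ^ (k + 1)" by simp
    show "0 \<le> q k" using one_le_power[of "2::real" "k + 1"] by (simp add: q_def)
  qed (auto simp: q_def \<rho>_def field_simps)
  define h where "h k t x = ennreal (exp (Re (u k * rad_deriv a t (of_real (q k) * cis (2 * pi * x)))))
      * indicator {0<..<1} t * indicator {0<..<1} x" for k t x
  have h_meas [measurable]: "(\<lambda>p. h k (fst p) (snd p)) \<in> borel_measurable (borel \<Otimes>\<^sub>M borel)" for k
    unfolding h_def by measurable
  have h_meas' [measurable]: "case_prod (h k) \<in> borel_measurable (lborel \<Otimes>\<^sub>M lborel)" for k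
    using h_meas[of k] by (simp add: case_prod_beta')
  define X where "X k t = (\<integral>\<^sup>+ x. h k t x \<partial>lborel)" for k t
  have X_meas [measurable]: "X k \<in> borel_measurable lborel" for k
    unfolding X_def by measurable
  have EX: "(\<integral>\<^sup>+ t. X k t \<partial>lborel) \<le> ennreal (exp (real k))" for k
  proof -
    have "(\<integral>\<^sup>+ t. X k t \<partial>lborel) = (\<integral>\<^sup>+ x. \<integral>\<^sup>+ t. h k t x \<partial>lborel \<partial>lborel)"
      unfolding X_def by (rule lborel_pair.Fubini'[symmetric]) simp
    also have "\<dots> \<le> (\<integral>\<^sup>+ x. ennreal (exp (real k)) * indicator {0<..<1::real} x \<partial>lborel)"
    proof (rule nn_integral_mono)
      fix x :: real
      have cq: "cmod (of_real (q k) * cis (2 * pi * x)) = q k"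
        using q by (simp add: norm_mult)
      have "(\<integral>\<^sup>+ t. h k t x \<partial>lborel) = (\<integral>\<^sup>+ t. ennreal (exp (Re (u k * rad_deriv a t (of_real (q k) * cis (2 * pi * x)))))
        * indicator {0<..<1} t \<partial>lborel) * indicator {0<..<1} x"
        unfolding h_def by (cases "x \<in> {0<..<1}") simp_all
      also have "\<dots> \<le> ennreal (exp ((cmod (u k))\<^sup>2 * rad_energy a (q k) / 2)) * indicator {0<..<1} x"
        using nn_integral_exp_rad_deriv_le[OF a, of "of_real (q k) * cis (2 * pi * x)" "u k"] q cq
        by (intro mult_right_mono) auto
      also have "\<dots> \<le> ennreal (exp (real k)) * indicator {0<..<1} x"
        using u[of k] by (intro mult_right_mono ennreal_leI) (auto simp: q_def)
      finally show "(\<integral>\<^sup>+ t. h k t x \<partial>lborel) \<le> ennreal (exp (real k)) * indicator {0<..<1} x" .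
    qed
    also have "\<dots> = ennreal (exp (real k))"
      by (subst nn_integral_cmult_indicator) auto
    finally show ?thesis .
  qed
  \<comment> \<open>The factor \<open>2 ^ (k + 1)\<close> is the loss in Cauchy's formula. Division
    by \<open>8 ^ k\<close> bounds the integrals by \<open>2 * (2 * 3 / 8) ^ k\<close>, where 3
    stands for \<open>exp 1\<close>.\<close>
  define Y where "Y t = (\<Sum>k. ennreal (2 ^ (k + 1) / 8 ^ k) * X k t)" for t
  have Y_meas: "Y \<in> borel_measurable lborel"
    unfolding Y_def by measurable
  have "(\<integral>\<^sup>+ t. Y t \<partial>lborel) = (\<Sum>k. ennreal (2 ^ (k + 1) / 8 ^ k) * (\<integral>\<^sup>+ t. X k t \<partial>lborel))"
    unfolding Y_def by (simp add: nn_integral_suminf nn_integral_cmult)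
  also have "\<dots> \<le> (\<Sum>k. ennreal (2 * (3 / 4) ^ k))"
  proof (intro suminf_le)
    fix k
    have "ennreal (2 ^ (k + 1) / 8 ^ k) * (\<integral>\<^sup>+ t. X k t \<partial>lborel)
      \<le> ennreal (2 ^ (k + 1) / 8 ^ k) * ennreal (3 ^ k)"
    proof (intro mult_left_mono order_trans[OF EX] ennreal_leI)
      have "exp (real k) = exp 1 ^ k"
        by (simp add: exp_of_nat_mult[symmetric])
      also have "\<dots> \<le> 3 ^ k"
        using exp_le by (intro power_mono) auto
      finally show "exp (real k) \<le> 3 ^ k" .
    qed simp
    also have "\<dots> = ennreal (2 * (3 / 4) ^ k)"
    proof -
      have "(2::real) ^ (k + 1) / 8 ^ k * 3 ^ k = 2 * (2 * 3 / 8) ^ k"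
        by (simp only: power_mult_distrib power_divide) simp
      then show ?thesis by (simp add: ennreal_mult[symmetric])
    qed
    finally show "ennreal (2 ^ (k + 1) / 8 ^ k) * (\<integral>\<^sup>+ t. X k t \<partial>lborel) \<le> ennreal (2 * (3 / 4) ^ k)" .
  qed auto
  also have "\<dots> = ennreal (2 * (1 / (1 - 3 / 4)))"
    by (intro suminf_ennreal_eq sums_mult geometric_sums) auto
  finally have "(\<integral>\<^sup>+ t. Y t \<partial>lborel) \<noteq> \<infinity>"
    by (auto simp: top_unique)
  then have "AE t in lborel. Y t \<noteq> \<infinity>"
    by (rule nn_integral_PInf_AE[OF Y_meas])
  then show ?thesis
  proof (rule AE_mp, intro AE_I2 impI)
    fix t :: real assume Yt: "Y t \<noteq> \<infinity>" and t: "t \<in> {0<..<1}"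
    \<comment> \<open>The lower bound 1 keeps \<open>ln T\<close> nonnegative when logarithms are
      taken later.\<close>
    define T where "T = max 1 (enn2real (Y t))"
    have "Y t = ennreal (enn2real (Y t))"
      using Yt by (simp add: less_top)
    also have "\<dots> \<le> ennreal T"
      by (intro ennreal_leI) (simp add: T_def)
    finally have T: "T \<ge> 1" "Y t \<le> ennreal T"
      by (simp_all add: T_def)
    have "exp (Re (u k * rad_deriv a t z)) \<le> T * 8 ^ k" if z: "cmod z \<le> 1 - 1 / 2 ^ k" for k z
    proof -
      have "ennreal (exp (Re (u k * rad_deriv a t z))) \<le> ennreal (q k / (q k - \<rho> k)) *
         (\<integral>\<^sup>+ x. ennreal (exp (Re (u k * rad_deriv a t (of_real (q k) * cis (2 * pi * x))))) * indicator {0<..<1} x \<partial>lborel)"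
        by (rule cmod_exp_le_circle_mean)
          (use q z in \<open>auto simp: \<rho>_def intro!: holomorphic_intros holomorphic_rad_deriv[OF a]\<close>)
      also have "\<dots> = ennreal (q k / (q k - \<rho> k)) * X k t"
        using t by (simp add: X_def h_def)
      also have "\<dots> \<le> ennreal (2 ^ (k + 1)) * X k t"
        by (intro mult_right_mono ennreal_leI q) auto
      also have "\<dots> = ennreal (8 ^ k) * (ennreal (2 ^ (k + 1) / 8 ^ k) * X k t)"
        by (simp add: mult.assoc[symmetric] ennreal_mult[symmetric])
      also have "\<dots> \<le> ennreal (8 ^ k) * Y t"
        unfolding Y_def
        using sum_le_suminf[OF summableI, of "{k}" "\<lambda>k. ennreal (2 ^ (k + 1) / 8 ^ k) * X k t"]
        by (intro mult_left_mono) simp_all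
      also have "\<dots> \<le> ennreal (8 ^ k) * ennreal T"
        by (intro mult_left_mono T) simp
      also have "\<dots> = ennreal (T * 8 ^ k)"
        using T by (simp add: ennreal_mult mult.commute)
      finally have "ennreal (exp (Re (u k * rad_deriv a t z))) \<le> ennreal (T * 8 ^ k)" .
      then show ?thesis
        using T by (subst (asm) ennreal_le_iff) auto
    qed
    then show "\<exists>T\<ge>1. \<forall>k z. cmod z \<le> 1 - 1 / 2 ^ k \<longrightarrow> exp (Re (u k * rad_deriv a t z)) \<le> T * 8 ^ k"
      using T by blast
  qed
qed

section \<open>Functions with a dyadic bound for the derivative\<close>

lemma dyadic_annulus:
  fixes x :: real
  assumes "0 \<le> x" "x < 1"
  obtains k where "k \<ge> 1" "1 - 1 / 2 ^ (k - 1) \<le> x" "x < 1 - 1 / 2 ^ k"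
proof -
  define k where "k = (LEAST k. x < 1 - 1 / 2 ^ k)"
  obtain m where "(1/2) ^ m < 1 - x"
    using real_arch_pow_inv[of "1 - x" "1/2"] assms by auto
  then have ex: "x < 1 - 1 / 2 ^ m"
    by (simp add: power_one_over)
  have k: "x < 1 - 1 / 2 ^ k"
    unfolding k_def by (rule LeastI[of _ m]) (rule ex)
  have "k \<ge> 1"
    using k assms by (cases k) auto
  moreover have "1 - 1 / 2 ^ (k - 1) \<le> x"
    using not_less_Least[of "k - 1" "\<lambda>k. x < 1 - 1 / 2 ^ k"] \<open>k \<ge> 1\<close> by (simp add: k_def[symmetric])
  ultimately show ?thesis using k that by blast
qed

text \<open>Discs of radius \<open>2 d\<close> about the points of the outer arc at distance \<open>d\<close> from each other
  cover a polar rectangle of thickness \<open>d\<close>; this avoids polar coordinates.\<close>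
lemma polar_rectangle_cover:
  assumes "0 < d" "d \<le> l" "0 \<le> R" "R \<le> 1"
  obtains A where "A \<in> sets borel" "emeasure lborel A \<le> ennreal (8 * pi * l * d)"
    "\<And>r s. R - d \<le> r \<Longrightarrow> r \<le> R \<Longrightarrow> \<theta> \<le> s \<Longrightarrow> s \<le> \<theta> + l \<Longrightarrow> complex_of_real r * cis s \<in> A"
proof -
  define N where "N = nat \<lfloor>l / d\<rfloor>"
  define D where "D j = cball (complex_of_real R * cis (\<theta> + real j * d)) (2 * d)" for j
  have N: "real N \<le> l / d" "l / d < real N + 1"
    using assms by (simp_all add: N_def)
  have area: "emeasure lborel (D j) = ennreal (4 * pi * d\<^sup>2)" for j
    using assms by (simp add: D_def emeasure_cball unit_ball_vol_2 power_mult_distrib mult_ac)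
  show ?thesis
  proof (rule that[of "\<Union>j\<le>N. D j"])
    show "(\<Union>j\<le>N. D j) \<in> sets borel"
      by (auto simp: D_def)
    have "emeasure lborel (\<Union>j\<le>N. D j) \<le> (\<Sum>j\<le>N. emeasure lborel (D j))"
      by (intro emeasure_subadditive_finite) (auto simp: D_def)
    also have "\<dots> = ennreal ((real N + 1) * (4 * pi * d\<^sup>2))"
      by (simp add: area sum_ennreal add.commute del: sum_constant) (simp add: add.commute)
    also have "\<dots> \<le> ennreal (8 * pi * l * d)"
    proof (rule ennreal_leI)
      have "(real N + 1) * d \<le> 2 * l"
        using N assms by (simp add: field_simps)
      then have "(real N + 1) * d * (4 * pi * d) \<le> 2 * l * (4 * pi * d)"
        using assms by (intro mult_right_mono) auto
      then show "(real N + 1) * (4 * pi * d\<^sup>2) \<le> 8 * pi * l * d"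
        by (simp add: power2_eq_square mult_ac)
    qed
    finally show "emeasure lborel (\<Union>j\<le>N. D j) \<le> ennreal (8 * pi * l * d)" .
    fix r s assume r: "R - d \<le> r" "r \<le> R" and s: "\<theta> \<le> s" "s \<le> \<theta> + l"
    define j where "j = nat \<lfloor>(s - \<theta>) / d\<rfloor>"
    have j: "real j \<le> (s - \<theta>) / d" "(s - \<theta>) / d < real j + 1"
      using assms s by (simp_all add: j_def)
    have "(s - \<theta>) / d \<le> l / d"
      using s assms by (intro divide_right_mono) auto
    then have "\<lfloor>(s - \<theta>) / d\<rfloor> \<le> \<lfloor>l / d\<rfloor>"
      by (rule floor_mono)
    then have "j \<le> N"
      by (simp add: j_def N_def nat_mono)
    have sj: "\<bar>s - (\<theta> + real j * d)\<bar> \<le> d"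
      using j assms by (simp add: field_simps abs_le_iff)
    have "dist (complex_of_real R * cis (\<theta> + real j * d)) (complex_of_real r * cis s)
      = cmod (complex_of_real R * (cis (\<theta> + real j * d) - cis s) + complex_of_real (R - r) * cis s)"
      by (simp add: dist_norm algebra_simps)
    also have "\<dots> \<le> R * cmod (cis (\<theta> + real j * d) - cis s) + (R - r)"
      by (rule order_trans[OF norm_triangle_ineq]) (use assms r in \<open>simp add: norm_mult del: of_real_diff\<close>)
    also have "\<dots> \<le> 1 * \<bar>(\<theta> + real j * d) - s\<bar> + d"
    proof -
      have "cmod (cis x - cis y) \<le> \<bar>x - y\<bar>" for x y
      proof -
        have "cmod (cis x - cis y) = cmod (cis y * (cis (x - y) - 1))"
          by (simp add: cis_mult algebra_simps)
        also have "\<dots> = cmod (exp (\<i> * complex_of_real (x - y)) - 1)"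
          by (simp add: norm_mult cis_conv_exp del: of_real_diff)
        also have "\<dots> \<le> \<bar>x - y\<bar>"
          using abs_sin_x_le_abs_x[of "(x - y) / 2"] by (simp only: dist_exp_i_1) simp
        finally show ?thesis .
      qed
      then show ?thesis
        using assms r by (intro add_mono mult_mono) auto
    qed
    also have "\<dots> \<le> 2 * d"
      using sj by (simp add: abs_minus_commute)
    finally show "complex_of_real r * cis s \<in> (\<Union>j\<le>N. D j)"
      using \<open>j \<le> N\<close> by (auto simp: D_def)
  qed
qed

text \<open>By Cauchy--Schwarz, \<open>\<Sum> 2 ^ -k * sqrt (W k)\<close> converges when \<open>\<Sum> k\<^sup>2 * 4 ^ -k * W k\<close> does; here the
  arithmetic--geometric mean inequality is enough.\<close>
lemma bounded_of_deriv_bound: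
  fixes f :: "complex \<Rightarrow> complex"
  assumes f: "f holomorphic_on ball 0 1"
    and W: "\<And>k z. k \<ge> 1 \<Longrightarrow> cmod z \<le> 1 - 1 / 2 ^ k \<Longrightarrow> (cmod (deriv f z))\<^sup>2 \<le> W k"
    and W0: "\<And>k. 0 \<le> W k"
    and sum: "summable (\<lambda>k. (real k)\<^sup>2 * W k / 4 ^ k)"
  shows "bounded (f ` ball 0 1)"
proof -
  define T where "T k = (real k)\<^sup>2 * W k / 4 ^ k + 1 / (real k)\<^sup>2" for k
  have T0: "T k \<ge> 0" for k
    unfolding T_def using W0 by auto
  have "summable (\<lambda>k. 1 / (real k)\<^sup>2)"
    using inverse_power_summable[of 2, where 'a = real] by (simp add: inverse_eq_divide)
  then have T_sum: "summable T"
    unfolding T_def using sum by (intro summable_add)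
  have step: "cmod (f z - f w) \<le> 2 * T k"
    if k: "k \<ge> 1" and z: "cmod z \<le> 1 - 1 / 2 ^ k" and w: "cmod w \<le> 1 - 1 / 2 ^ k"
      and d: "cmod (z - w) \<le> 1 / 2 ^ (k - 1)" for k z w
  proof -
    define \<rho> where "\<rho> = 1 - 1 / (2::real) ^ k"
    have "\<rho> < 1" by (simp add: \<rho>_def)
    have "cmod (f z - f w) \<le> sqrt (W k) * cmod (z - w)"
    proof (rule field_differentiable_bound[of "cball 0 \<rho>" f "deriv f"])
      fix x :: complex assume "x \<in> cball 0 \<rho>"
      then have x: "x \<in> ball 0 1" "cmod x \<le> 1 - 1 / 2 ^ k"
        using \<open>\<rho> < 1\<close> by (simp_all add: \<rho>_def le_less_trans[OF _ \<open>\<rho> < 1\<close>, unfolded \<rho>_def])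
      show "(f has_field_derivative deriv f x) (at x within cball 0 \<rho>)"
        using holomorphic_derivI[OF f _ x(1)] DERIV_subset by blast
      show "cmod (deriv f x) \<le> sqrt (W k)"
        using W[OF k x(2)] by (rule real_le_rsqrt)
    qed (use z w in \<open>auto simp: \<rho>_def\<close>)
    also have "\<dots> \<le> sqrt (W k) * (2 / 2 ^ k)"
      using d k W0 by (intro mult_left_mono) (auto simp: power_diff)
    \<comment> \<open>The factor \<open>real k\<close> is inserted so that the squares of both
      factors have convergent sums.\<close>
    also have "\<dots> = 2 * ((real k * sqrt (W k) / 2 ^ k) * (1 / real k))"
      using k by simp
    also have "\<dots> \<le> 2 * T k"
    proof -
      have "2 * (x * y) \<le> x\<^sup>2 + y\<^sup>2" for x y :: real
        using zero_le_power2[of "x - y"] by (simp add: power2_diff algebra_simps)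
      then have amgm: "x * y \<le> x\<^sup>2 + y\<^sup>2" if "x \<ge> 0" "y \<ge> 0" for x y :: real
        using that by (smt (verit) mult_nonneg_nonneg)
      have "(real k * sqrt (W k) / 2 ^ k) * (1 / real k) \<le> (real k * sqrt (W k) / 2 ^ k)\<^sup>2 + (1 / real k)\<^sup>2"
        using W0 by (intro amgm) auto
      also have "(real k * sqrt (W k) / 2 ^ k)\<^sup>2 + (1 / real k)\<^sup>2 = T k"
        using W0 by (simp add: T_def power_mult_distrib power_divide power2_eq_square[of "2 ^ k"]
            power_mult_distrib[symmetric])
      finally show ?thesis by simp
    qed
    finally show ?thesis .
  qed
  have radial: "cmod (f z - f 0) \<le> 2 * (\<Sum>j\<in>{1..k}. T j)" if "k \<ge> 1" "cmod z \<le> 1 - 1 / 2 ^ k" for k z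
    using that
  proof (induction k arbitrary: z rule: nat_induct_at_least)
    case base
    then show ?case using step[of 1 z 0] by simp
  next
    case (Suc k)
    define \<rho> where "\<rho> = 1 - 1 / (2::real) ^ k"
    have \<rho>: "0 \<le> \<rho>" "\<rho> \<le> 1 - 1 / 2 ^ Suc k"
      by (auto simp: \<rho>_def field_simps)
    show ?case
    proof (cases "cmod z \<le> \<rho>")
      case True
      then show ?thesis
        using Suc.IH[of z] T0[of "Suc k"] by (simp add: \<rho>_def)
    next
      case False
      \<comment> \<open>\<open>w\<close> is the radial projection of \<open>z\<close> to the circle
        of radius \<open>\<rho>\<close>: the path to 0 crosses one annulus at a time.\<close>
      define w where "w = complex_of_real (\<rho> / cmod z) * z"
      have z0: "cmod z > 0" using False \<rho> by linarith
      have cw: "cmod w = \<rho>"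
        using z0 \<rho> by (simp add: w_def norm_mult norm_divide)
      have "z - w = complex_of_real (1 - \<rho> / cmod z) * z"
        by (simp add: w_def algebra_simps)
      then have "cmod (z - w) = \<bar>1 - \<rho> / cmod z\<bar> * cmod z"
        by (metis norm_mult norm_of_real)
      also have "\<dots> = cmod z - \<rho>"
        using z0 False by (simp add: abs_of_nonneg field_simps)
      finally have "cmod (z - w) \<le> 1 / 2 ^ (Suc k - 1)"
        using Suc.prems by (simp add: \<rho>_def field_simps)
      then have "cmod (f z - f w) \<le> 2 * T (Suc k)"
        using step[of "Suc k" z w] Suc.prems cw \<rho> by simp
      moreover have "cmod (f w - f 0) \<le> 2 * (\<Sum>j\<in>{1..k}. T j)"
        using Suc.IH[of w] cw by (simp add: \<rho>_def)
      ultimately show ?thesis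
        using norm_triangle_ineq[of "f z - f w" "f w - f 0"] by simp
    qed
  qed
  show ?thesis
    unfolding bounded_iff
  proof (intro exI ballI)
    fix y assume "y \<in> f ` ball 0 1"
    then obtain z where y: "y = f z" and z: "cmod z < 1" by auto
    obtain k where k: "k \<ge> 1" "cmod z < 1 - 1 / 2 ^ k"
      using dyadic_annulus[of "cmod z"] z by auto
    have "cmod (f z - f 0) \<le> 2 * (\<Sum>j\<in>{1..k}. T j)"
      using radial k by simp
    also have "(\<Sum>j\<in>{1..k}. T j) \<le> suminf T"
      using T0 T_sum by (intro sum_le_suminf) auto
    finally show "cmod y \<le> cmod (f 0) + 2 * suminf T"
      using norm_triangle_sub[of "f z" "f 0"] y by simp
  qed
qed

lemma H1_of_bounded:
  assumes f: "f holomorphic_on ball 0 1" and b: "bounded (f ` ball 0 1)"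
  shows "f \<in> H1"
proof -
  obtain M where "\<forall>z\<in>ball 0 1. cmod (f z) \<le> M"
    using b by (auto simp: bounded_iff)
  then have M: "\<And>z. cmod z < 1 \<Longrightarrow> cmod (f z) \<le> M"
    by simp
  have "integral {0..2*pi} (\<lambda>s. cmod (f (complex_of_real r * cis s))) \<le> M * (2 * pi)"
    if r: "0 \<le> r" "r < 1" for r
  proof -
    have "norm (integral {0..2*pi} (\<lambda>s. cmod (f (complex_of_real r * cis s)))) \<le> M * (2 * pi - 0)"
    proof (rule integral_bound)
      show "continuous_on {0..2*pi} (\<lambda>s. cmod (f (complex_of_real r * cis s)))"
        by (intro continuous_intros continuous_on_compose2[OF holomorphic_on_imp_continuous_on[OF f]])
          (use r in \<open>auto simp: norm_mult\<close>)
      show "norm (cmod (f (complex_of_real r * cis s))) \<le> M" for s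
        using M[of "complex_of_real r * cis s"] r by (simp add: norm_mult)
    qed simp
    then show ?thesis by simp
  qed
  then show ?thesis
    using f unfolding H1_def unit_disc_def by blast
qed

text \<open>Cut the box into dyadic annular pieces. The piece with index \<open>k\<close> has a
  cover of area of order \<open>l / 2 ^ k\<close>, and the weight there is of order
  \<open>1 / 2 ^ k\<close>, so it contributes at most a constant times
  \<open>l * W k / 4 ^ k\<close>. Only annuli with \<open>1 / 2 ^ k < l / (2 * pi)\<close> meet the
  box, and for these the logarithm is at most \<open>2 * k\<close>, which accounts for the factor
  \<open>k^2\<close> in the hypothesis.\<close>

lemma BMOA_log_Hinf_of_deriv_bound:
  fixes f :: "complex \<Rightarrow> complex"
  assumes f: "f holomorphic_on ball 0 1"
    and W: "\<And>k z. k \<ge> 1 \<Longrightarrow> cmod z \<le> 1 - 1 / 2 ^ k \<Longrightarrow> (cmod (deriv f z))\<^sup>2 \<le> W k"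
    and W0: "\<And>k. 0 \<le> W k"
    and sum: "summable (\<lambda>k. (real k)\<^sup>2 * W k / 4 ^ k)"
  shows "f \<in> BMOA_log \<inter> Hinf"
proof -
  define S where "S = (\<Sum>k. (real k)\<^sup>2 * W k / 4 ^ k)"
  have S0: "S \<ge> 0"
    unfolding S_def using W0 by (intro suminf_nonneg sum) auto
  have b: "bounded (f ` ball 0 1)"
    by (rule bounded_of_deriv_bound[OF f W W0 sum])
  have main: "(\<integral>\<^sup>+ z \<in> carleson_box \<theta> l.
          ennreal ((1 - (cmod z)\<^sup>2) * (cmod (deriv f z))\<^sup>2 / pi) \<partial>lborel)
        * ennreal ((ln (2 / l))\<^sup>2) \<le> ennreal (128 * (S + 1) * l)"
    if l: "0 < l" "l \<le> 2 * pi" for \<theta> l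
  proof -
    define K where "K = {k::nat. k \<ge> 1 \<and> 1 / 2 ^ k < l / (2 * pi)}"
    have "\<exists>A. A \<in> sets borel \<and> emeasure lborel A \<le> ennreal (8 * pi * l / 2 ^ k) \<and>
       (\<forall>r s. 1 - 1 / 2 ^ (k - 1) \<le> r \<and> r \<le> 1 - 1 / 2 ^ k \<and> \<theta> \<le> s \<and> s \<le> \<theta> + l \<longrightarrow> complex_of_real r * cis s \<in> A)"
      if "k \<in> K" for k
    proof -
      have k: "k \<ge> 1" "1 / 2 ^ k < l / (2 * pi)" using that by (auto simp: K_def)
      \<comment> \<open>The covering lemma asks that the thickness of the piece be at most
        \<open>l\<close>.\<close>
      have "l / (2 * pi) \<le> l / 1"
        using l pi_gt3 by (intro divide_left_mono) auto
      with k have "1 / 2 ^ k \<le> l" by simp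
      then obtain A where A: "A \<in> sets borel" "emeasure lborel A \<le> ennreal (8 * pi * l * (1 / 2 ^ k))"
        "\<And>r s. (1 - 1 / 2 ^ k) - 1 / 2 ^ k \<le> r \<Longrightarrow> r \<le> 1 - 1 / 2 ^ k \<Longrightarrow> \<theta> \<le> s \<Longrightarrow> s \<le> \<theta> + l \<Longrightarrow> complex_of_real r * cis s \<in> A"
        using polar_rectangle_cover[of "1 / 2 ^ k" l "1 - 1 / 2 ^ k" \<theta>] by auto
      have eq: "(1 - 1 / 2 ^ k) - 1 / 2 ^ k = 1 - 1 / (2::real) ^ (k - 1)"
        using k by (simp add: power_diff)
      show ?thesis
        using A(1,2) A(3)[unfolded eq] by (intro exI[of _ A]) simp
    qed
    then obtain A where A_borel: "\<And>k. k \<in> K \<Longrightarrow> A k \<in> sets borel"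
      and A_meas: "\<And>k. k \<in> K \<Longrightarrow> emeasure lborel (A k) \<le> ennreal (8 * pi * l / 2 ^ k)"
      and A_in: "\<And>k r s. k \<in> K \<Longrightarrow> 1 - 1 / 2 ^ (k - 1) \<le> r \<Longrightarrow> r \<le> 1 - 1 / 2 ^ k \<Longrightarrow>
        \<theta> \<le> s \<Longrightarrow> s \<le> \<theta> + l \<Longrightarrow> complex_of_real r * cis s \<in> A k"
      by metis
    define B where "B k = (if k \<in> K then A k else {})" for k
    have B_borel [measurable]: "B k \<in> sets borel" for k
      using A_borel by (simp add: B_def)
    define c where "c k = (4 / 2 ^ k) * W k / pi" for k
    have c0: "c k \<ge> 0" for k using W0 by (simp add: c_def)
    \<comment> \<open>The integrand is dominated by a countable combination of indicators of Borel
      sets, whose integral is computed termwise.\<close>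
    have pointwise: "ennreal ((1 - (cmod z)\<^sup>2) * (cmod (deriv f z))\<^sup>2 / pi) * indicator (carleson_box \<theta> l) z
       \<le> (\<Sum>k. ennreal (c k) * indicator (B k) z)" for z
    proof (cases "z \<in> carleson_box \<theta> l")
      case True
      then obtain r s where z: "z = complex_of_real r * cis s" and s: "\<theta> \<le> s" "s \<le> \<theta> + l"
        and r: "1 - l / (2 * pi) \<le> r" "r < 1"
        by (auto simp: carleson_box_def)
      have "1 - l / (2 * pi) \<ge> 0"
        using l by simp
      then have r0: "r \<ge> 0" using r by linarith
      then have cz: "cmod z = r" by (simp add: z norm_mult)
      obtain k where k: "k \<ge> 1" "1 - 1 / 2 ^ (k - 1) \<le> r" "r < 1 - 1 / 2 ^ k"
        using dyadic_annulus[OF r0 r(2)] by blast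
      have "k \<in> K"
        using k r by (auto simp: K_def)
      then have zB: "z \<in> B k"
        using A_in[of k r s] k s by (simp add: B_def z)
      have "1 - (cmod z)\<^sup>2 \<le> 2 * (1 - r)"
        using zero_le_power2[of "1 - r"] by (simp add: cz power2_diff)
      also have "\<dots> \<le> 4 / 2 ^ k"
        using k by (simp add: power_diff)
      finally have "(1 - (cmod z)\<^sup>2) * (cmod (deriv f z))\<^sup>2 / pi \<le> c k"
        unfolding c_def using W[of k z] k cz W0
        by (intro divide_right_mono mult_mono) auto
      then have "ennreal ((1 - (cmod z)\<^sup>2) * (cmod (deriv f z))\<^sup>2 / pi) * indicator (carleson_box \<theta> l) z
        \<le> ennreal (c k) * indicator (B k) z"
        using True zB by (simp add: ennreal_leI)
      also have "\<dots> \<le> (\<Sum>k. ennreal (c k) * indicator (B k) z)"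
        using sum_le_suminf[OF summableI, of "{k}" "\<lambda>k. ennreal (c k) * indicator (B k) z"]
        by (simp only: sum.insert finite.emptyI empty_iff not_False_eq_True sum.empty add_0_right) simp
      finally show ?thesis .
    qed simp
    have term_le: "ennreal (c k) * emeasure lborel (B k) * ennreal ((ln (2 / l))\<^sup>2)
        \<le> ennreal (128 * l * ((real k)\<^sup>2 * W k / 4 ^ k))" for k
    proof (cases "k \<in> K")
      case True
      then have k: "k \<ge> 1" "1 / 2 ^ k < l / (2 * pi)" by (auto simp: K_def)
      have "ln (2 / l) \<le> 2 * real k"
      proof -
        have "2 / l \<le> 2 ^ k"
        proof -
          have "2 \<le> 2 * pi" using pi_gt3 by simp
          also have "\<dots> \<le> l * 2 ^ k" using k l by (simp add: field_simps)
          finally show ?thesis using l by (simp add: field_simps)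
        qed
        then have "ln (2 / l) \<le> ln (2 ^ k)"
          using l by (subst ln_le_cancel_iff) auto
        also have "\<dots> \<le> real k"
          using ln_2_less_1 by (simp add: ln_realpow mult_left_le)
        finally show ?thesis by linarith
      qed
      \<comment> \<open>For arcs longer than 2 the logarithm is negative; there \<open>l / 2\<close>
        is at most \<open>pi\<close>, hence below 4.\<close>
      moreover have "- ln (2 / l) \<le> 2 * real k"
      proof -
        have "- ln (2 / l) = ln (l / 2)"
          using l by (simp add: ln_div)
        also have "\<dots> \<le> ln 4"
          using l pi_less_4 by (subst ln_le_cancel_iff) auto
        also have "\<dots> = 2 * ln (2::real)"
          using ln_realpow[of "2::real" 2] by simp
        also have "\<dots> \<le> 2 * real k"
          using ln_2_less_1 k by linarith
        finally show ?thesis .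
      qed
      ultimately have "\<bar>ln (2 / l)\<bar> \<le> 2 * real k" by linarith
      then have ln2: "(ln (2 / l))\<^sup>2 \<le> 4 * (real k)\<^sup>2"
        using power_mono[of "\<bar>ln (2 / l)\<bar>" "2 * real k" 2] by (simp add: power_mult_distrib)
      have "ennreal (c k) * emeasure lborel (B k) * ennreal ((ln (2 / l))\<^sup>2)
        \<le> ennreal (c k) * ennreal (8 * pi * l / 2 ^ k) * ennreal (4 * (real k)\<^sup>2)"
        using True A_meas by (intro mult_mono ennreal_leI ln2) (auto simp: B_def)
      also have "\<dots> = ennreal (c k * (8 * pi * l / 2 ^ k) * (4 * (real k)\<^sup>2))"
      proof -
        have "0 \<le> c k" "0 \<le> 8 * pi * l / 2 ^ k" "0 \<le> 4 * (real k)\<^sup>2"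
          using c0 l by auto
        then show ?thesis
          by (simp only: ennreal_mult mult_nonneg_nonneg)
      qed
      \<comment> \<open>The constant is \<open>4 * 8 * 4\<close>: weight, area of the cover, square
        of \<open>2 * k\<close>.\<close>
      also have "c k * (8 * pi * l / 2 ^ k) * (4 * (real k)\<^sup>2) = 128 * l * ((real k)\<^sup>2 * W k / (2 ^ k * 2 ^ k))"
        by (simp add: c_def field_simps)
      also have "(2::real) ^ k * 2 ^ k = 4 ^ k"
        by (simp add: power_mult_distrib[symmetric])
      finally show ?thesis .
    qed (simp add: B_def)
    have "(\<integral>\<^sup>+ z \<in> carleson_box \<theta> l. ennreal ((1 - (cmod z)\<^sup>2) * (cmod (deriv f z))\<^sup>2 / pi) \<partial>lborel)
      \<le> (\<integral>\<^sup>+ z. (\<Sum>k. ennreal (c k) * indicator (B k) z) \<partial>lborel)"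
      by (intro nn_integral_mono pointwise)
    also have "\<dots> = (\<Sum>k. ennreal (c k) * emeasure lborel (B k))"
      by (subst nn_integral_suminf) (auto simp: nn_integral_cmult_indicator)
    finally have "(\<integral>\<^sup>+ z \<in> carleson_box \<theta> l. ennreal ((1 - (cmod z)\<^sup>2) * (cmod (deriv f z))\<^sup>2 / pi) \<partial>lborel)
        * ennreal ((ln (2 / l))\<^sup>2) \<le> (\<Sum>k. ennreal (c k) * emeasure lborel (B k)) * ennreal ((ln (2 / l))\<^sup>2)"
      by (intro mult_right_mono) auto
    also have "\<dots> = (\<Sum>k. ennreal (c k) * emeasure lborel (B k) * ennreal ((ln (2 / l))\<^sup>2))"
      by (rule ennreal_suminf_multc[symmetric])
    also have "\<dots> \<le> (\<Sum>k. ennreal (128 * l * ((real k)\<^sup>2 * W k / 4 ^ k)))"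
      by (intro suminf_le term_le) auto
    also have "\<dots> = ennreal (128 * l * S)"
    proof (rule suminf_ennreal_eq)
      show "(\<lambda>k. 128 * l * ((real k)\<^sup>2 * W k / 4 ^ k)) sums (128 * l * S)"
        unfolding S_def by (intro sums_mult summable_sums sum)
    qed (use l W0 in auto)
    \<comment> \<open>Passing to \<open>S + 1\<close> makes the constant positive, as
      \<open>BMOA_log\<close> asks.\<close>
    also have "\<dots> \<le> ennreal (128 * (S + 1) * l)"
      using l S0 by (intro ennreal_leI) (auto simp: algebra_simps)
    finally show ?thesis .
  qed
  have "f \<in> BMOA_log"
    unfolding BMOA_log_def using H1_of_bounded[OF f b] main S0
    by (auto intro!: exI[of _ "128 * (S + 1)"])
  moreover have "f \<in> Hinf"
    using f b by (simp add: Hinf_def unit_disc_def)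
  ultimately show ?thesis by blast
qed

section \<open>Almost sure membership\<close>

text \<open>Two geometric series meet at the peak \<open>k = N\<close>. The induction runs on an
  explicit bound for each partial sum, before and after the peak.\<close>

lemma sum_dyadic_peak_le:
  "(\<Sum>k<K. if k < N then 2 ^ k / 2 ^ N else 2 ^ N / 2 ^ k) \<le> (3::real)"
proof -
  have "(\<Sum>k<K. if k < N then 2 ^ k / 2 ^ N else 2 ^ N / 2 ^ k)
      \<le> (if K \<le> N then 2 ^ K / 2 ^ N else 3 - 2 * (2 ^ N / 2 ^ K) :: real)"
  proof (induction K)
    case (Suc K)
    consider "K < N" | "K = N" | "K > N" by linarith
    then show ?case using Suc by cases auto
  qed simp
  also have "\<dots> \<le> 3"
  proof (cases "K \<le> N")
    case True
    then have "(2::real) ^ K \<le> 2 ^ N" by (intro power_increasing) auto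
    then have le: "(2::real) ^ K / 2 ^ N \<le> 1" by simp
    show ?thesis
      unfolding if_P[OF True] by (rule order_trans[OF le]) simp
  qed simp
  finally show ?thesis .
qed

lemma cube_le_two_power: "(1 + real j) ^ 3 \<le> 8 * 2 ^ j"
proof (cases "j < 4")
  case True
  then have "j = 0 \<or> j = 1 \<or> j = 2 \<or> j = 3" by linarith
  then show ?thesis by auto
next
  case False
  then have "4 \<le> j" by simp
  then show ?thesis
  proof (induction j rule: nat_induct_at_least)
    case (Suc j)
    \<comment> \<open>From 4 on, successive cubes have ratio at most \<open>125 / 64\<close>, which
      is below 2.\<close>
    have "(1 + real (Suc j)) ^ 3 \<le> (5 / 4 * (1 + real j)) ^ 3"
      using Suc.hyps by (intro power_mono) auto
    also have "\<dots> = 125 / 64 * (1 + real j) ^ 3"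
      by (simp only: power_mult_distrib power_divide) simp
    also have "\<dots> \<le> 2 * (8 * 2 ^ j)"
      using Suc.IH by (intro mult_mono) auto
    finally show ?case by simp
  qed simp
qed

text \<open>One term of the exponential series. The cube turns \<open>2 ^ j\<close> into decay
  \<open>1 / 8 ^ j\<close>, enough against a growth of \<open>4 ^ j\<close> in
  \<open>sum_dyadic_weight_le\<close>.\<close>

lemma exp_minus_le_inverse_cube:
  fixes x :: real
  assumes "x > 0"
  shows "exp (- x) \<le> 6 / x ^ 3"
proof -
  have "(\<Sum>n\<in>{3}. x ^ n /\<^sub>R fact n) \<le> exp x"
    using exp_converges[of x] assms by (intro order_trans[OF sum_le_suminf eq_refl]) (auto simp: sums_iff)
  then have "x ^ 3 / 6 \<le> exp x"
    by (simp add: fact_numeral field_simps)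
  then show ?thesis
    using assms by (simp add: exp_minus field_simps)
qed

text \<open>The terms of the sum decay geometrically away from \<open>k = log\<^sub>2 (m + 1)\<close>.\<close>
lemma sum_dyadic_weight_le:
  "(\<Sum>k<K. (real k) ^ 3 / 4 ^ k * ((1 - 1 / 2 ^ (k + 1)) ^ m)\<^sup>2)
     \<le> 6912 * (1 + ln (real (Suc m)) ^ 3) / (real (Suc m))\<^sup>2"
proof -
  obtain N where N: "2 ^ N \<le> Suc m" "Suc m < 2 ^ (N + 1)"
    using ex_power_ivl1[of 2 "Suc m"] by auto
  have N': "(2::real) ^ N \<le> real (Suc m)" "real (Suc m) < 2 * 2 ^ N"
    using of_nat_mono[OF N(1), where 'a = real] N(2)[folded of_nat_less_iff[where 'a = real]] by simp_all
  define v where "v k = (if k < N then 2 ^ k / 2 ^ N else 2 ^ N / 2 ^ k :: real)" for k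
  have q: "0 \<le> 1 - 1 / (2::real) ^ (k + 1)" "1 - 1 / (2::real) ^ (k + 1) \<le> 1" for k
    using one_le_power[of "2::real" "k + 1"] by simp_all
  have term_le: "(real k) ^ 3 / 4 ^ k * ((1 - 1 / 2 ^ (k + 1)) ^ m)\<^sup>2 \<le> 18 * (1 + real N) ^ 3 / 4 ^ N * v k" for k
  proof (cases "k < N")
    case True
    define j where "j = N - k"
    have Nj: "N = k + j" using True by (simp add: j_def)
    have "((1 - 1 / (2::real) ^ (k + 1)) ^ m)\<^sup>2 \<le> (exp (- (1 / 2 ^ (k + 1))) ^ m)\<^sup>2"
      using q exp_ge_add_one_self[of "- (1 / (2::real) ^ (k + 1))"] by (intro power_mono) auto
    also have "\<dots> = exp (- (real m / 2 ^ k))"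
      by (simp add: exp_of_nat_mult[symmetric] power2_eq_square exp_add[symmetric])
    \<comment> \<open>Replacing \<open>m\<close> by \<open>Suc m\<close> costs a factor at most
      \<open>exp 1\<close>.\<close>
    also have "\<dots> = exp (1 / 2 ^ k) * exp (- (real (Suc m) / 2 ^ k))"
      by (simp add: exp_add[symmetric] diff_divide_distrib[symmetric] add_divide_distrib)
    also have "\<dots> \<le> 3 * (6 / 8 ^ j)"
    proof (intro mult_mono)
      have "exp (1 / 2 ^ k) \<le> exp (1::real)" by simp
      then show "exp (1 / 2 ^ k) \<le> (3::real)" using exp_le by linarith
      have "2 ^ j \<le> real (Suc m) / 2 ^ k"
        using N' by (simp add: Nj power_add field_simps)
      then have "exp (- (real (Suc m) / 2 ^ k)) \<le> exp (- (2 ^ j))" by simp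
      also have "\<dots> \<le> 6 / (2 ^ j) ^ 3"
        by (intro exp_minus_le_inverse_cube) simp
      also have "((2::real) ^ j) ^ 3 = 8 ^ j"
        by (simp add: power_mult[symmetric] mult.commute[of j]) (simp add: power_mult)
      finally show "exp (- (real (Suc m) / 2 ^ k)) \<le> 6 / 8 ^ j" .
    qed auto
    finally have e: "((1 - 1 / (2::real) ^ (k + 1)) ^ m)\<^sup>2 \<le> 18 / 8 ^ j" by simp
    have "(real k) ^ 3 / 4 ^ k * ((1 - 1 / 2 ^ (k + 1)) ^ m)\<^sup>2 \<le> (1 + real N) ^ 3 / 4 ^ k * (18 / 8 ^ j)"
      using True by (intro mult_mono divide_right_mono power_mono e) auto
    also have "\<dots> = 18 * (1 + real N) ^ 3 / 4 ^ N * (2 ^ k / 2 ^ N)"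
    proof -
      have "(8::real) ^ j = 4 ^ j * 2 ^ j" by (simp add: power_mult_distrib[symmetric])
      then show ?thesis by (simp add: Nj power_add mult_ac)
    qed
    finally show ?thesis using True by (simp add: v_def)
  next
    case False
    define j where "j = k - N"
    have Nj: "k = N + j" using False by (simp add: j_def)
    \<comment> \<open>Beyond the peak the power of the radius is bounded by 1. The cube of
      \<open>1 + j\<close> costs \<open>2 ^ j\<close>, so \<open>1 / 4 ^ j\<close> still leaves
      \<open>1 / 2 ^ j\<close>.\<close>
    have "real k \<le> (1 + real N) * (1 + real j)"
      by (simp add: Nj algebra_simps)
    then have "(real k) ^ 3 \<le> ((1 + real N) * (1 + real j)) ^ 3"
      by (intro power_mono) auto
    also have "\<dots> \<le> (1 + real N) ^ 3 * (8 * 2 ^ j)"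
      unfolding power_mult_distrib by (intro mult_left_mono cube_le_two_power) auto
    finally have "(real k) ^ 3 / 4 ^ k * ((1 - 1 / 2 ^ (k + 1)) ^ m)\<^sup>2 \<le> (1 + real N) ^ 3 * (8 * 2 ^ j) / 4 ^ k * 1"
      using q by (intro mult_mono divide_right_mono) (auto simp: power_le_one)
    also have "\<dots> = 8 * (1 + real N) ^ 3 / 4 ^ N * (2 ^ N / 2 ^ k)"
    proof -
      have "(4::real) ^ j = 2 ^ j * 2 ^ j" by (simp add: power_mult_distrib[symmetric])
      then show ?thesis by (simp add: Nj power_add)
    qed
    also have "\<dots> \<le> 18 * (1 + real N) ^ 3 / 4 ^ N * (2 ^ N / 2 ^ k)"
      by (intro mult_right_mono divide_right_mono) auto
    finally show ?thesis using False by (simp add: v_def)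
  qed
  have "(\<Sum>k<K. (real k) ^ 3 / 4 ^ k * ((1 - 1 / 2 ^ (k + 1)) ^ m)\<^sup>2) \<le> (\<Sum>k<K. 18 * (1 + real N) ^ 3 / 4 ^ N * v k)"
    by (intro sum_mono term_le)
  also have "\<dots> = 18 * (1 + real N) ^ 3 / 4 ^ N * (\<Sum>k<K. v k)"
    by (simp add: sum_distrib_left)
  also have "\<dots> \<le> 18 * (1 + real N) ^ 3 / 4 ^ N * 3"
    unfolding v_def by (intro mult_left_mono sum_dyadic_peak_le) auto
  also have "\<dots> = 54 * ((1 + real N) ^ 3 * (1 / 4 ^ N))" by simp
  also have "\<dots> \<le> 54 * ((32 * (1 + ln (real (Suc m)) ^ 3)) * (4 / (real (Suc m))\<^sup>2))"
  proof (intro mult_left_mono mult_mono)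
    define L where "L = ln (real (Suc m))"
    have L0: "L \<ge> 0" by (simp add: L_def)
    have "real N * ln 2 \<le> L"
      unfolding L_def using ln_mono[OF N'(1)] by (simp add: ln_realpow)
    moreover have "real N * (1 / 2) \<le> real N * ln 2"
      using ln2_ge_two_thirds by (intro mult_left_mono) auto
    ultimately have "1 + real N \<le> 1 + 2 * L" by linarith
    then have "(1 + real N) ^ 3 \<le> (1 + 2 * L) ^ 3" by (intro power_mono) auto
    also have "\<dots> \<le> 32 * (1 + L ^ 3)"
    proof -
      \<comment> \<open>The power mean inequality for cubes, with its remainder explicit.\<close>
      have "4 * (1 + x ^ 3) - (1 + x) ^ 3 = 3 * (1 + x) * (1 - x)\<^sup>2" for x :: real
        by (simp add: power3_eq_cube power2_eq_square algebra_simps)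
      then have "(1 + 2 * L) ^ 3 \<le> 4 * (1 + (2 * L) ^ 3)"
        using L0 by (smt (verit) mult_nonneg_nonneg zero_le_power2)
      then show ?thesis using zero_le_power[OF L0, of 3] by (simp add: power_mult_distrib)
    qed
    finally show "(1 + real N) ^ 3 \<le> 32 * (1 + ln (real (Suc m)) ^ 3)" by (simp add: L_def)
    have "(real (Suc m))\<^sup>2 \<le> (2 * 2 ^ N)\<^sup>2"
      using N' by (intro power_mono) auto
    also have "\<dots> = 4 * (4::real) ^ N"
      by (simp add: power_mult_distrib power2_eq_square) (simp add: power_mult_distrib[symmetric])
    finally show "1 / 4 ^ N \<le> 4 / (real (Suc m))\<^sup>2"
      by (simp add: field_simps)
  qed auto
  \<comment> \<open>\<open>6912 = 18 * 3 * 32 * 4\<close>.\<close>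
  also have "\<dots> = 6912 * (1 + ln (real (Suc m)) ^ 3) / (real (Suc m))\<^sup>2" by simp
  finally show ?thesis .
qed

text \<open>Exchange the sums over \<open>k\<close> and over the coefficients. The square of the
  coefficient of index \<open>n\<close> then carries the factor \<open>n^2\<close> times the sum
  bounded in \<open>sum_dyadic_weight_le\<close>, which is a constant times
  \<open>1 + (ln n)^3\<close>.\<close>

lemma summable_dyadic_rad_energy:
  assumes bdd: "\<forall>n. cmod (a (Suc n)) \<le> B"
    and s: "summable (\<lambda>n. (cmod (a (Suc n)))\<^sup>2 * (1 + ln (real (Suc n)) ^ 3))"
  shows "summable (\<lambda>k. (real k) ^ 3 / 4 ^ k * (1 + rad_energy a (1 - 1 / 2 ^ (k + 1))))"
proof -
  define q where "q k = 1 - 1 / (2::real) ^ (k + 1)" for k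
  have q: "0 \<le> q k" "q k < 1" for k
    using one_le_power[of "2::real" "k + 1"] by (simp_all add: q_def)
  define w where "w k = (real k) ^ 3 / 4 ^ k" for k
  have w0: "w k \<ge> 0" for k by (simp add: w_def)
  have e_sum: "summable (\<lambda>m. (cmod (of_nat (Suc m) * a (Suc m) * of_real (q k) ^ m))\<^sup>2)" for k
    by (rule summable_rad_energy[OF bdd]) (use q[of k] in simp)
  have energy0: "rad_energy a (q k) \<ge> 0" for k
    unfolding rad_energy_def by (intro suminf_nonneg e_sum) auto
  have 1: "summable w"
  proof (rule summableI_nonneg_bounded)
    fix K
    \<comment> \<open>The case \<open>m = 0\<close> of the weight estimate.\<close>
    have "(\<Sum>k<K. w k) = (\<Sum>k<K. (real k) ^ 3 / 4 ^ k * ((1 - 1 / 2 ^ (k + 1)) ^ 0)\<^sup>2)"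
      by (simp add: w_def)
    also have "\<dots> \<le> 6912 * (1 + ln (real (Suc 0)) ^ 3) / (real (Suc 0))\<^sup>2"
      by (rule sum_dyadic_weight_le)
    finally show "(\<Sum>k<K. w k) \<le> 6912" by simp
  qed (rule w0)
  have 2: "summable (\<lambda>k. w k * rad_energy a (q k))"
  proof (rule summableI_nonneg_bounded)
    fix K
    have "(\<Sum>k<K. w k * rad_energy a (q k))
        = (\<Sum>k<K. \<Sum>m. w k * (cmod (of_nat (Suc m) * a (Suc m) * of_real (q k) ^ m))\<^sup>2)"
      unfolding rad_energy_def by (intro sum.cong refl suminf_mult[symmetric] e_sum)
    also have "\<dots> = (\<Sum>m. \<Sum>k<K. w k * (cmod (of_nat (Suc m) * a (Suc m) * of_real (q k) ^ m))\<^sup>2)"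
      by (intro suminf_sum[symmetric] summable_mult e_sum)
    also have "\<dots> \<le> (\<Sum>m. 6912 * ((cmod (a (Suc m)))\<^sup>2 * (1 + ln (real (Suc m)) ^ 3)))"
    proof (intro suminf_le)
      fix m
      have "(\<Sum>k<K. w k * (cmod (of_nat (Suc m) * a (Suc m) * of_real (q k) ^ m))\<^sup>2)
          = (real (Suc m))\<^sup>2 * (cmod (a (Suc m)))\<^sup>2 * (\<Sum>k<K. w k * (q k ^ m)\<^sup>2)"
        unfolding sum_distrib_left using q
        by (intro sum.cong) (auto simp: norm_mult norm_power power_mult_distrib mult_ac simp del: of_nat_Suc)
      also have "\<dots> \<le> (real (Suc m))\<^sup>2 * (cmod (a (Suc m)))\<^sup>2 * (6912 * (1 + ln (real (Suc m)) ^ 3) / (real (Suc m))\<^sup>2)"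
        using sum_dyadic_weight_le[of m K] unfolding w_def q_def by (intro mult_left_mono) auto
      also have "\<dots> = 6912 * ((cmod (a (Suc m)))\<^sup>2 * (1 + ln (real (Suc m)) ^ 3))"
        by (simp del: of_nat_Suc)
      finally show "(\<Sum>k<K. w k * (cmod (of_nat (Suc m) * a (Suc m) * of_real (q k) ^ m))\<^sup>2)
        \<le> 6912 * ((cmod (a (Suc m)))\<^sup>2 * (1 + ln (real (Suc m)) ^ 3))" .
    qed (intro summable_sum summable_mult e_sum s)+
    finally show "(\<Sum>k<K. w k * rad_energy a (q k)) \<le> (\<Sum>m. 6912 * ((cmod (a (Suc m)))\<^sup>2 * (1 + ln (real (Suc m)) ^ 3)))" .
  qed (use w0 energy0 in auto)
  show ?thesis
    using summable_add[OF 1 2] by (simp add: w_def q_def distrib_left)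
qed

text \<open>The logarithm vanishes at frequency 1 only; from frequency 2 on it is at least 1/2, so 1
  is at most 8 times its cube.\<close>

lemma log_weight_summable:
  assumes s: "summable (\<lambda>n. (cmod (a (Suc n)))\<^sup>2 * (ln (real (Suc n))) ^ 3)"
  shows "summable (\<lambda>n. (cmod (a (Suc n)))\<^sup>2 * (1 + ln (real (Suc n)) ^ 3))"
    and "\<exists>B. \<forall>n. cmod (a (Suc n)) \<le> B"
proof -
  have le: "(cmod (a (Suc n)))\<^sup>2 \<le> 8 * ((cmod (a (Suc n)))\<^sup>2 * (ln (real (Suc n))) ^ 3)" if "n \<ge> 1" for n
  proof -
    have "1 / 2 \<le> ln (2::real)" using ln2_ge_two_thirds by linarith
    also have "\<dots> \<le> ln (real (Suc n))" using that by (intro ln_mono) auto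
    finally have "(1 / 2) ^ 3 \<le> ln (real (Suc n)) ^ 3" by (intro power_mono) auto
    then have "1 \<le> 8 * ln (real (Suc n)) ^ 3" by (simp add: power_one_over)
    then show ?thesis
      using mult_left_mono[of 1 "8 * ln (real (Suc n)) ^ 3" "(cmod (a (Suc n)))\<^sup>2"] by (simp add: mult_ac)
  qed
  have a2: "summable (\<lambda>n. (cmod (a (Suc n)))\<^sup>2)"
    by (rule summable_comparison_test'[OF summable_mult[OF s, of 8], of 1]) (use le in auto)
  then show "summable (\<lambda>n. (cmod (a (Suc n)))\<^sup>2 * (1 + ln (real (Suc n)) ^ 3))"
    using summable_add[OF a2 s] by (simp add: distrib_left)
  have "(cmod (a (Suc n)))\<^sup>2 \<le> (\<Sum>n. (cmod (a (Suc n)))\<^sup>2)" for n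
    using sum_le_suminf[OF a2, of "{n}"] by simp
  then have "cmod (a (Suc n)) \<le> sqrt (\<Sum>n. (cmod (a (Suc n)))\<^sup>2)" for n
    by (rule real_le_rsqrt)
  then show "\<exists>B. \<forall>n. cmod (a (Suc n)) \<le> B" by blast
qed

text \<open>Taking logarithms in the exponential bounds gives real and imaginary parts of the
  derivative of size at most \<open>L * k / S k\<close>, hence \<open>W k = L^2 * k * V k\<close>.
  The condition on \<open>W\<close> then asks exactly for the convergence of the sum of
  \<open>k^3 * V k / 4 ^ k\<close>.\<close>

lemma AE_rad_series_in_BMOA_log:
  assumes s: "summable (\<lambda>n. (cmod (a (Suc n)))\<^sup>2 * (ln (real (Suc n))) ^ 3)"
  shows "AE t in lborel. t \<in> {0..1} \<longrightarrow> rad_series a t \<in> BMOA_log \<inter> Hinf"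
proof -
  obtain B where bdd: "\<forall>n. cmod (a (Suc n)) \<le> B"
    using log_weight_summable(2)[OF s] by blast
  \<comment> \<open>The added 1 allows division by \<open>V k\<close> even when the energy
    vanishes.\<close>
  define V where "V k = 1 + rad_energy a (1 - 1 / 2 ^ (k + 1))" for k
  have V_sum: "summable (\<lambda>k. (real k) ^ 3 / 4 ^ k * V k)"
    unfolding V_def by (rule summable_dyadic_rad_energy[OF bdd log_weight_summable(1)[OF s]])
  have energy0: "rad_energy a (1 - 1 / 2 ^ (k + 1)) \<ge> 0" for k
  proof -
    have "cmod (of_real (1 - 1 / 2 ^ (k + 1))) < 1"
      using one_le_power[of "2::real" "k + 1"] unfolding norm_of_real by simp
    then show ?thesis
      unfolding rad_energy_def by (intro suminf_nonneg summable_rad_energy[OF bdd]) auto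
  qed
  then have V: "V k \<ge> 1" for k by (simp add: V_def)
  \<comment> \<open>This multiplier makes \<open>S k\<close> squared times the energy at most
    \<open>2 * k\<close>, the hypothesis of \<open>AE_exp_rad_deriv_bound\<close>.\<close>
  define S where "S k = sqrt (2 * real k / V k)" for k
  have S2: "(S k)\<^sup>2 = 2 * real k / V k" for k
    unfolding S_def using V[of k] by (intro real_sqrt_pow2) auto
  have ae: "AE t in lborel. t \<in> {0<..<1} \<longrightarrow> (\<exists>T\<ge>1. \<forall>k z. cmod z \<le> 1 - 1 / 2 ^ k \<longrightarrow>
      exp (Re ((of_real (S k) * \<zeta>) * rad_deriv a t z)) \<le> T * 8 ^ k)" if "cmod \<zeta> = 1" for \<zeta>
  proof (rule AE_exp_rad_deriv_bound[OF bdd])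
    fix k
    have "rad_energy a (1 - 1 / 2 ^ (k + 1)) \<le> V k" by (simp add: V_def)
    then have "(2 * real k / V k) * rad_energy a (1 - 1 / 2 ^ (k + 1)) \<le> (2 * real k / V k) * V k"
      using V[of k] by (intro mult_left_mono) auto
    then show "(cmod (of_real (S k) * \<zeta>))\<^sup>2 * rad_energy a (1 - 1 / 2 ^ (k + 1)) \<le> 2 * real k"
      using that V[of k] by (simp add: norm_mult S2)
  qed
  have "AE t in lborel. t \<noteq> (0::real)" "AE t in lborel. t \<noteq> (1::real)"
    by (rule AE_lborel_singleton)+
  then show ?thesis
    \<comment> \<open>Four directions bound the real and the imaginary part from both sides.\<close>
    using ae[of 1, simplified] ae[of "-1", simplified] ae[of \<i>, simplified] ae[of "-\<i>", simplified]
  proof eventually_elim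
    case (elim t)
    show ?case
    proof
      assume "t \<in> {0..1}"
      with elim have t: "t \<in> {0<..<1}" by auto
      define F where "F = rad_deriv a t"
      obtain T1 T2 T3 T4 where T: "T1 \<ge> 1" "T2 \<ge> 1" "T3 \<ge> 1" "T4 \<ge> 1"
        and b1: "\<And>k z. cmod z \<le> 1 - 1 / 2 ^ k \<Longrightarrow> exp (S k * Re (F z)) \<le> T1 * 8 ^ k"
        and b2: "\<And>k z. cmod z \<le> 1 - 1 / 2 ^ k \<Longrightarrow> exp (- (S k * Re (F z))) \<le> T2 * 8 ^ k"
        and b3: "\<And>k z. cmod z \<le> 1 - 1 / 2 ^ k \<Longrightarrow> exp (- (S k * Im (F z))) \<le> T3 * 8 ^ k"
        and b4: "\<And>k z. cmod z \<le> 1 - 1 / 2 ^ k \<Longrightarrow> exp (S k * Im (F z)) \<le> T4 * 8 ^ k"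
        using elim t unfolding F_def by auto
      \<comment> \<open>\<open>L\<close> absorbs each \<open>ln T\<close> and \<open>ln 8\<close>,
        which is at most 3.\<close>
      define L where "L = ln (T1 * T2 * T3 * T4) + 3"
      have L: "ln T + real k * ln 8 \<le> L * real k" if "T \<in> {T1, T2, T3, T4}" "k \<ge> 1" for T k
      proof -
        have "ln (T1 * T2 * T3 * T4) = ln T1 + ln T2 + ln T3 + ln T4"
          using T by (simp add: ln_mult)
        moreover have "0 \<le> ln T1" "0 \<le> ln T2" "0 \<le> ln T3" "0 \<le> ln T4"
          using T by auto
        ultimately have 1: "0 \<le> L - 3" "ln T \<le> L - 3"
          using that(1) by (auto simp: L_def)
        have "(L - 3) * 1 \<le> (L - 3) * real k"
          using 1 that by (intro mult_left_mono) auto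
        moreover have "ln (8::real) = 3 * ln 2"
          using ln_realpow[of "2::real" 3] by simp
        then have "real k * ln 8 \<le> real k * 3"
          using ln_2_less_1 by (intro mult_left_mono) auto
        ultimately show ?thesis using 1 by (simp add: algebra_simps)
      qed
      have log_bound: "x \<le> L * real k" if "exp x \<le> T * 8 ^ k" "T \<in> {T1, T2, T3, T4}" "k \<ge> 1" for x T k
      proof -
        have T0: "T \<ge> 1" using that T by auto
        have "x = ln (exp x)" by simp
        also have "\<dots> \<le> ln (T * 8 ^ k)" using that(1) T0 by (intro ln_mono) auto
        also have "\<dots> = ln T + real k * ln 8" using T0 by (simp add: ln_mult ln_realpow)
        also have "\<dots> \<le> L * real k" by (rule L[OF that(2,3)])
        finally show ?thesis .
      qed
      define W where "W k = L\<^sup>2 * real k * V k" for k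
      have W0: "W k \<ge> 0" for k using V[of k] by (simp add: W_def)
      have F_le: "(cmod (F z))\<^sup>2 \<le> W k" if k: "k \<ge> 1" and z: "cmod z \<le> 1 - 1 / 2 ^ k" for k z
      proof -
        have re: "\<bar>S k * Re (F z)\<bar> \<le> L * real k"
          using log_bound[OF b1[OF z] _ k] log_bound[OF b2[OF z] _ k] by (simp add: abs_le_iff)
        have im: "\<bar>S k * Im (F z)\<bar> \<le> L * real k"
          using log_bound[OF b3[OF z] _ k] log_bound[OF b4[OF z] _ k] by (simp add: abs_le_iff)
        have "(S k)\<^sup>2 * (cmod (F z))\<^sup>2 = (S k * Re (F z))\<^sup>2 + (S k * Im (F z))\<^sup>2"
          by (simp add: cmod_power2 power_mult_distrib distrib_left)
        also have "\<dots> \<le> (L * real k)\<^sup>2 + (L * real k)\<^sup>2"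
          using power_mono[OF re, of 2] power_mono[OF im, of 2] by simp
        also have "\<dots> = (2 * real k / V k) * W k"
          using V[of k] by (simp add: W_def power2_eq_square)
        finally have "(2 * real k / V k) * (cmod (F z))\<^sup>2 \<le> (2 * real k / V k) * W k"
          by (simp only: S2)
        then show ?thesis
          using V[of k] k by (subst (asm) mult_le_cancel_left_pos) auto
      qed
      show "rad_series a t \<in> BMOA_log \<inter> Hinf"
      proof (rule BMOA_log_Hinf_of_deriv_bound[OF holomorphic_rad_series[OF bdd], where W = W])
        fix k :: nat and z :: complex
        assume k: "k \<ge> 1" and z: "cmod z \<le> 1 - 1 / 2 ^ k"
        have "0 < 1 / (2::real) ^ k" by simp
        with z have "cmod z < 1" by linarith
        then show "(cmod (deriv (rad_series a t) z))\<^sup>2 \<le> W k"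
          using F_le[OF k z] by (simp add: deriv_rad_series[OF bdd] F_def)
      next
        show "summable (\<lambda>k. (real k)\<^sup>2 * W k / 4 ^ k)"
          using summable_mult[OF V_sum, of "L\<^sup>2"]
          by (simp add: W_def power2_eq_square power3_eq_cube mult_ac)
      qed (rule W0)
    qed
  qed
qed

section \<open>Sharpness\<close>

text \<open>Multiplication by \<open>4 ^ m\<close> shifts the base-four expansion. Digits moved in
  front of the units place get an even factor, so modulo 2 only the tail beginning with
  \<open>s m\<close> survives.\<close>

lemma four_adic_tail:
  fixes s :: "nat \<Rightarrow> nat"
  assumes s: "\<And>j. s j \<le> 1"
  defines "T \<equiv> \<lambda>m. \<Sum>j. real (s (m + j)) / 4 ^ j"
  shows "0 \<le> T m" "T m \<le> 4 / 3" "T m = real (s m) + T (Suc m) / 4"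
    and "\<exists>K::int. 4 ^ m * T 0 = 2 * of_int K + T m"
proof -
  have geo: "(\<lambda>j. 1 / (4::real) ^ j) sums (4 / 3)"
    using geometric_sums[of "1 / 4 :: real"] by (simp add: power_one_over)
  have le: "real (s (m + j)) / 4 ^ j \<le> 1 / 4 ^ j" for m j
    using s[of "m + j"] by (intro divide_right_mono) auto
  have sum: "summable (\<lambda>j. real (s (m + j)) / 4 ^ j)" for m
    by (rule summable_comparison_test'[OF sums_summable[OF geo], of 0]) (use le in auto)
  show "0 \<le> T m"
    unfolding T_def by (intro suminf_nonneg sum) auto
  show "T m \<le> 4 / 3"
    unfolding T_def by (intro sums_le[OF le summable_sums[OF sum] geo])
  have rec: "T m = real (s m) + T (Suc m) / 4" for m
  proof -
    have "(\<Sum>j. real (s (m + Suc j)) / 4 ^ Suc j) = (\<Sum>j. real (s (Suc m + j)) / 4 ^ j / 4)"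
      by (simp add: mult.commute)
    also have "\<dots> = T (Suc m) / 4"
      unfolding T_def by (rule suminf_divide[OF sum])
    finally show ?thesis
      using suminf_split_head[OF sum, of m] by (simp add: T_def)
  qed
  show "T m = real (s m) + T (Suc m) / 4" by (rule rec)
  show "\<exists>K::int. 4 ^ m * T 0 = 2 * of_int K + T m"
  proof (induction m)
    case 0
    show ?case by (rule exI[of _ 0]) simp
  next
    case (Suc m)
    then obtain K :: int where K: "4 ^ m * T 0 = 2 * of_int K + T m" by blast
    have "4 ^ Suc m * T 0 = 4 * (4 ^ m * T 0)" by simp
    also have "\<dots> = 2 * of_int (4 * K + 2 * int (s m)) + T (Suc m)"
      unfolding K rec[of m] by (simp add: algebra_simps)
    finally show ?case by blast
  qed
qed

text \<open>The cosine of 75 degrees is about 0.2588; its square comes from the double angle 150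
  degrees. The range \<open>5 / 12\<close> is the total error in
  \<open>four_adic_cos\<close>.\<close>

lemma cos_ge_quarter:
  assumes "0 \<le> y" "y \<le> 5 / 12"
  shows "1 / 4 \<le> cos (pi * y)"
proof -
  have "cos (5 * pi / 12) \<le> cos (pi * y)"
    using assms by (intro cos_monotone_0_pi_le) auto
  moreover have "1 / 4 \<le> cos (5 * pi / 12)"
  proof (rule power2_le_imp_le)
    have "2 * (cos (5 * pi / 12))\<^sup>2 - 1 = cos (2 * (5 * pi / 12))"
      by (rule cos_double_cos[symmetric])
    also have "\<dots> = cos (pi - pi / 6)"
      by (rule arg_cong[of _ _ cos]) simp
    also have "\<dots> = - (sqrt 3 / 2)"
      unfolding cos_pi_minus cos_30 ..
    finally have "(cos (5 * pi / 12))\<^sup>2 = (1 - sqrt 3 / 2) / 2" by simp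
    moreover have "sqrt 3 \<le> 7 / 4"
      by (rule real_le_lsqrt) (auto simp: power2_eq_square)
    ultimately show "(1 / 4)\<^sup>2 \<le> (cos (5 * pi / 12))\<^sup>2"
      by (simp add: power2_eq_square)
    show "0 \<le> cos (5 * pi / 12)"
      by (rule cos_ge_zero) auto
  qed
  ultimately show ?thesis by linarith
qed

text \<open>Modulo \<open>2 * pi\<close>, the part with \<open>4 ^ i\<close> is
  \<open>pi * s i\<close>, which gives the sign, plus at most \<open>pi / 3\<close>, as tails are at
  most \<open>4 / 3\<close>. The part with \<open>4 ^ m\<close> is at most \<open>pi / 12\<close>,
  since two zero digits divide the tail by 16. The errors add up to at most
  \<open>5 * pi / 12\<close>.\<close>

lemma four_adic_cos:
  fixes s :: "nat \<Rightarrow> nat"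
  assumes s: "\<And>j. s j \<le> 1" and m: "s m = 0" "s (Suc m) = 0"
  defines "\<theta> \<equiv> pi * (\<Sum>j. real (s j) / 4 ^ j)"
  shows "1 / 4 \<le> (-1) ^ s i * cos (real (4 ^ m + 4 ^ i) * \<theta>)"
proof -
  define T where "T m = (\<Sum>j. real (s (m + j)) / 4 ^ j)" for m
  note tail = four_adic_tail[of s, OF s, folded T_def]
  obtain K L :: int where K: "4 ^ m * T 0 = 2 * of_int K + T m" and L: "4 ^ i * T 0 = 2 * of_int L + T i"
    using tail(4) by metis
  define y where "y = T m + T (Suc i) / 4"
  have "T m = T (Suc (Suc m)) / 16"
    using tail(3)[of m] tail(3)[of "Suc m"] m by simp
  then have y: "0 \<le> y" "y \<le> 5 / 12"
    unfolding y_def using tail(1,2)[of "Suc (Suc m)"] tail(1,2)[of "Suc i"] by simp_all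
  have "real (4 ^ m + 4 ^ i) * \<theta> = pi * (4 ^ m * T 0 + 4 ^ i * T 0)"
    by (simp add: \<theta>_def T_def algebra_simps)
  also have "\<dots> = (pi * y + pi * real (s i)) + of_int (K + L) * (2 * pi)"
    unfolding K L y_def by (subst (2) tail(3)) (simp add: algebra_simps)
  finally have "cos (real (4 ^ m + 4 ^ i) * \<theta>) = cos (pi * y + pi * real (s i))"
    using sin_int_2pin[of "K + L"] cos_int_2pin[of "K + L"] by (simp add: cos_add mult_ac)
  also have "\<dots> = (-1) ^ s i * cos (pi * y)"
    using s[of i] by (cases "s i = 0") (auto simp: le_Suc_eq)
  finally show ?thesis
    using cos_ge_quarter[OF y] by (simp add: mult.assoc[symmetric] power_mult_distrib[symmetric])
qed

section \<open>Coefficients on blocks of comparable frequencies\<close>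

text \<open>The growth condition leaves at least \<open>m (Suc k) / 2\<close> elements in
  \<open>exps k\<close>, separates the blocks and forces \<open>2 ^ k \<le> m k\<close>.\<close>

locale rapid_exponents =
  fixes m :: "nat \<Rightarrow> nat"
  assumes m_0: "1 \<le> m 0" and m_Suc: "2 * m k + 4 \<le> m (Suc k)"
begin

lemma m_strict: "strict_mono m"
  unfolding strict_mono_Suc_iff
proof
  show "m k < m (Suc k)" for k
    using m_Suc[of k] by linarith
qed

lemma m_le: "k \<le> l \<Longrightarrow> m k \<le> m l"
  using m_strict by (simp add: strict_mono_less_eq)

lemma m_ge: "2 ^ k \<le> m k"
proof (induction k)
  case (Suc k)
  then show ?case using m_Suc[of k] by simp
qed (use m_0 in simp)

text \<open>The interval starts at \<open>m k + 2\<close> so that the digits at \<open>m k\<close>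
  and \<open>m k + 1\<close> can be zero, as \<open>four_adic_cos\<close> requires.\<close>

definition exps :: "nat \<Rightarrow> nat set" where
  "exps k = {m k + 2..<m (Suc k)}"

text \<open>The leading power makes all frequencies of a block comparable; the lower power
  distinguishes them and reads off a digit of the angle.\<close>

definition block :: "nat \<Rightarrow> nat set" where
  "block k = (\<lambda>i. 4 ^ m (Suc k) + 4 ^ i) ` exps k"

text \<open>With \<open>M = m (Suc k)\<close>, about \<open>M\<close> coefficients
  \<open>2 ^ k / M^2\<close> contribute, for \<open>\<delta>\<close> below
  \<open>1 / 16 ^ k\<close>, order \<open>1 / 4 ^ k\<close> to the weighted sum, but order
  \<open>2 ^ k\<close> to the logarithmic Bloch quantity once aligned. Off the blocks
  \<open>1 / 2 ^ n\<close> keeps the coefficients positive at bounded cost.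
  \<open>block_unique\<close> makes the description operator meaningful.\<close>

definition amp :: "nat \<Rightarrow> real" where
  "amp n = (if \<exists>k. n \<in> block k
     then 2 ^ (THE k. n \<in> block k) / (real (m (Suc (THE k. n \<in> block k))))\<^sup>2 else 1 / 2 ^ n)"

lemma exps_unique: "i \<in> exps k \<Longrightarrow> i \<in> exps l \<Longrightarrow> k = l"
proof (induction k l rule: linorder_wlog)
  case (le k l)
  then show ?case
    using m_le[of "Suc k" l] by (cases "k = l") (auto simp: exps_def)
qed simp

lemma m_Suc_notin_exps: "m (Suc k) \<notin> exps l" "Suc (m (Suc k)) \<notin> exps l"
  using m_le[of "Suc k" l] m_le[of "Suc l" "Suc k"] by (cases "l \<le> k"; auto simp: exps_def)+

lemma block_bounds:
  assumes "n \<in> block k"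
  shows "4 ^ m (Suc k) \<le> n" "n \<le> 2 * 4 ^ m (Suc k)" "n < 4 ^ Suc (m (Suc k))"
proof -
  obtain i where i: "i < m (Suc k)" "n = 4 ^ m (Suc k) + 4 ^ i"
    using assms by (auto simp: block_def exps_def)
  have "(4::nat) ^ i \<le> 4 ^ m (Suc k)"
    using i by (intro power_increasing) auto
  then show "4 ^ m (Suc k) \<le> n" "n \<le> 2 * 4 ^ m (Suc k)" using i by auto
  moreover have "0 < (4::nat) ^ m (Suc k)" by simp
  ultimately show "n < 4 ^ Suc (m (Suc k))"
    unfolding power_Suc by linarith
qed

lemma block_unique: "n \<in> block k \<Longrightarrow> n \<in> block l \<Longrightarrow> k = l"
proof (induction k l rule: linorder_wlog)
  case (le k l)
  show ?case
  proof (rule ccontr)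
    assume "k \<noteq> l"
    then have "Suc (m (Suc k)) \<le> m (Suc l)"
      using le m_strict by (simp add: Suc_le_eq strict_mono_less)
    then have "(4::nat) ^ Suc (m (Suc k)) \<le> 4 ^ m (Suc l)"
      by (intro power_increasing) auto
    then show False
      using block_bounds(3)[OF le(2)] block_bounds(1)[OF le(3)] by linarith
  qed
qed simp

lemma amp_block: "n \<in> block k \<Longrightarrow> amp n = 2 ^ k / (real (m (Suc k)))\<^sup>2"
  unfolding amp_def using block_unique by (auto simp: the_equality)

lemma amp_other: "(\<And>k. n \<notin> block k) \<Longrightarrow> amp n = 1 / 2 ^ n"
  by (simp add: amp_def)

lemma m_pos: "0 < m k"
  using m_ge[of k] by (metis less_le_trans zero_less_numeral zero_less_power)

lemma amp_pos: "0 < amp n"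
proof (cases "\<exists>k. n \<in> block k")
  case True
  then show ?thesis using m_pos by (auto simp: amp_block)
qed (simp add: amp_other)

lemma amp_le_1: "amp n \<le> 1"
proof (cases "\<exists>k. n \<in> block k")
  case True
  then obtain k where k: "n \<in> block k" by blast
  have "(2::nat) ^ k \<le> 2 ^ Suc k" by simp
  also have "\<dots> \<le> m (Suc k)" by (rule m_ge)
  also have "\<dots> \<le> (m (Suc k))\<^sup>2" by (simp add: power2_eq_square)
  finally have "real (2 ^ k) \<le> real ((m (Suc k))\<^sup>2)" by (rule of_nat_mono)
  then show ?thesis
    unfolding amp_block[OF k] using m_pos[of "Suc k"] by (simp add: divide_le_eq)
qed (simp add: amp_other)

lemma finite_block: "finite (block k)"
  by (simp add: block_def exps_def)

lemma card_block: "card (block k) = m (Suc k) - m k - 2"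
  unfolding block_def by (subst card_image) (auto simp: inj_on_def exps_def)

text \<open>The powers of \<open>M\<close> cancel: at most \<open>M\<close> terms,
  \<open>1 / M^4\<close> from the squared amplitude, \<open>64 * M^3\<close> from the logarithm.
  What remains is \<open>4 ^ k / 16 ^ k\<close>.\<close>

lemma sum_block_le:
  assumes \<delta>: "\<And>i j. 1 \<le> i \<Longrightarrow> i \<le> j \<Longrightarrow> \<delta> j \<le> \<delta> i" "\<And>n. 1 \<le> n \<Longrightarrow> 0 < \<delta> n"
    and small: "\<delta> (4 ^ m (Suc k)) \<le> 1 / 16 ^ k"
  shows "(\<Sum>n\<in>block k. (amp n)\<^sup>2 * \<delta> n * (ln (real n)) ^ 3) \<le> 64 * (1 / 4) ^ k"
proof -
  define M where "M = m (Suc k)"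
  have M: "M > 0" using m_pos by (simp add: M_def)
  have "(\<Sum>n\<in>block k. (amp n)\<^sup>2 * \<delta> n * (ln (real n)) ^ 3)
     \<le> (\<Sum>n\<in>block k. (2 ^ k / (real M)\<^sup>2)\<^sup>2 * (1 / 16 ^ k) * (4 * real M) ^ 3)"
  proof (rule sum_mono)
    fix n assume n: "n \<in> block k"
    have n1: "1 \<le> n" "4 ^ M \<le> n" "n < 4 ^ Suc M"
      using block_bounds[OF n] one_le_power[of "4::nat" M] by (auto simp: M_def)
    have "\<delta> n \<le> 1 / 16 ^ k"
      using \<delta>(1)[of "4 ^ M" n] n1 small by (simp add: M_def)
    moreover have "ln (real n) \<le> 4 * real M"
    proof -
      have "real n \<le> 4 ^ Suc M"
        using of_nat_mono[OF less_imp_le[OF n1(3)], where 'a = real] by simp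
      then have "ln (real n) \<le> ln (4 ^ Suc M)" using n1 by (intro ln_mono) auto
      also have "\<dots> = real (Suc M) * (2 * ln 2)"
        using ln_realpow[of "2::real" 2] by (subst ln_realpow) auto
      also have "\<dots> \<le> (2 * real M) * 2"
        using ln_2_less_1 M by (intro mult_mono) auto
      finally show ?thesis by simp
    qed
    moreover have "0 \<le> ln (real n)" using n1 by simp
    ultimately show "(amp n)\<^sup>2 * \<delta> n * (ln (real n)) ^ 3
      \<le> (2 ^ k / (real M)\<^sup>2)\<^sup>2 * (1 / 16 ^ k) * (4 * real M) ^ 3"
      unfolding amp_block[OF n] M_def[symmetric] using \<delta>(2)[OF n1(1)]
      by (intro mult_mono power_mono mult_nonneg_nonneg) auto
  qed
  also have "\<dots> = real (card (block k)) * (64 * (1 / 4) ^ k / real M)"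
  proof -
    have "(16::real) ^ k = 4 ^ k * 4 ^ k" "(2::real) ^ k * 2 ^ k = 4 ^ k"
      by (simp_all add: power_mult_distrib[symmetric])
    then have "(2 ^ k / (real M)\<^sup>2)\<^sup>2 * (1 / 16 ^ k) * (4 * real M) ^ 3 = 64 * (1 / 4) ^ k / real M"
      using M by (simp add: power2_eq_square power3_eq_cube power_one_over field_simps)
    then show ?thesis by simp
  qed
  also have "\<dots> \<le> real M * (64 * (1 / 4) ^ k / real M)"
    by (intro mult_right_mono) (auto simp: card_block M_def)
  also have "\<dots> = 64 * (1 / 4) ^ k" using M by simp
  finally show ?thesis .
qed

text \<open>The blocks contribute a geometric series in \<open>k\<close>. Off the blocks, the
  squared amplitude \<open>1 / 4 ^ n\<close> against a cubed logarithm of at most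
  \<open>8 * 2 ^ n\<close> leaves a geometric series in \<open>n\<close>.\<close>

lemma summable_amp:
  assumes \<delta>: "\<And>i j. 1 \<le> i \<Longrightarrow> i \<le> j \<Longrightarrow> \<delta> j \<le> \<delta> i" "\<And>n. 1 \<le> n \<Longrightarrow> 0 < \<delta> n"
    and small: "\<And>k. \<delta> (4 ^ m (Suc k)) \<le> 1 / 16 ^ k"
  shows "summable (\<lambda>n. (amp (Suc n))\<^sup>2 * \<delta> (Suc n) * (ln (real (Suc n))) ^ 3)"
proof -
  define g where "g n = (amp n)\<^sup>2 * \<delta> n * (ln (real n)) ^ 3" for n
  have g0: "0 \<le> g n" if "1 \<le> n" for n
    unfolding g_def using \<delta>(2)[OF that] that by (intro mult_nonneg_nonneg) auto
  have g_other: "g n \<le> 8 * \<delta> 1 * (1 / 2) ^ n" if n: "1 \<le> n" and "\<And>k. n \<notin> block k" for n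
  proof -
    have "ln (real n) ^ 3 \<le> 8 * 2 ^ n"
    proof -
      have "ln (real n) \<le> real n" using ln_le_minus_one[of "real n"] n by simp
      then have "ln (real n) ^ 3 \<le> real n ^ 3" using n by (intro power_mono) auto
      also have "\<dots> \<le> (1 + real n) ^ 3" by (intro power_mono) auto
      also have "\<dots> \<le> 8 * 2 ^ n" by (rule cube_le_two_power)
      finally show ?thesis .
    qed
    then have "g n \<le> (1 / 2 ^ n)\<^sup>2 * \<delta> 1 * (8 * 2 ^ n)"
      unfolding g_def amp_other[OF that(2)] using \<delta>(1)[of 1 n] \<delta>(2)[of n] \<delta>(2)[of 1] n
      by (intro mult_mono mult_nonneg_nonneg) auto
    also have "\<dots> = 8 * \<delta> 1 * (1 / 2) ^ n"
      by (simp add: power2_eq_square power_one_over)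
    finally show ?thesis .
  qed
  have "summable (\<lambda>n. g (Suc n))"
  proof (rule summableI_nonneg_bounded)
    fix K :: nat
    define A where "A = {1..K}"
    \<comment> \<open>Every frequency in \<open>block k\<close> exceeds \<open>k\<close>, so
      frequencies up to \<open>K\<close> meet only blocks with \<open>k \<le> K\<close>.\<close>
    define L where "L = (\<Union>k\<le>K. block k)"
    have notin: "n \<notin> block k" if "n \<in> A - L" for n k
    proof
      assume n: "n \<in> block k"
      then have "k > K" using that by (auto simp: L_def not_le)
      moreover have "k < n"
      proof -
        have "k < 2 ^ Suc k" using less_exp[of k] unfolding power_Suc by linarith
        also have "\<dots> \<le> m (Suc k)" by (rule m_ge)
        also have "\<dots> < 4 ^ m (Suc k)" by (rule power_gt_expt) simp
        also have "\<dots> \<le> n" by (rule block_bounds(1)[OF n])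
        finally show ?thesis .
      qed
      ultimately show False using that by (simp add: A_def)
    qed
    have "(\<Sum>n<K. g (Suc n)) = sum g A"
      unfolding A_def by (rule sum.reindex_bij_witness[of _ "\<lambda>n. n - 1" Suc]) auto
    also have "\<dots> = sum g (A - L) + sum g (A \<inter> L)"
      by (subst sum.union_disjoint[symmetric]) (auto simp: A_def intro!: sum.cong)
    also have "sum g (A - L) \<le> (\<Sum>n\<in>A - L. 8 * \<delta> 1 * (1 / 2) ^ n)"
      by (intro sum_mono g_other notin) (auto simp: A_def)
    also have "\<dots> \<le> (\<Sum>n. 8 * \<delta> 1 * (1 / 2) ^ n)"
      using \<delta>(2)[of 1] by (intro sum_le_suminf summable_mult summable_geometric) (auto simp: A_def)
    also have "sum g (A \<inter> L) \<le> sum g L"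
    proof (rule sum_mono2)
      fix n assume "n \<in> L - A \<inter> L"
      then obtain k where "n \<in> block k" by (auto simp: L_def)
      then have "1 \<le> n" using block_bounds(1)[of n k] one_le_power[of "4::nat" "m (Suc k)"] by linarith
      then show "0 \<le> g n" by (rule g0)
    qed (auto simp: L_def finite_block)
    also have "sum g L = (\<Sum>k\<le>K. sum g (block k))"
      unfolding L_def by (rule sum.UNION_disjoint) (use finite_block block_unique in auto)
    also have "\<dots> \<le> (\<Sum>k\<le>K. 64 * (1 / 4) ^ k)"
      unfolding g_def by (intro sum_mono sum_block_le[of \<delta>, OF \<delta> small])
    also have "\<dots> \<le> (\<Sum>k. 64 * (1 / 4) ^ k)"
      by (intro sum_le_suminf summable_mult summable_geometric) auto
    finally show "(\<Sum>n<K. g (Suc n)) \<le> (\<Sum>n. 8 * \<delta> 1 * (1 / 2) ^ n) + (\<Sum>k. 64 * (1 / 4) ^ k)"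
      by simp
  qed (simp add: g0)
  then show ?thesis by (simp add: g_def)
qed

text \<open>The angle \<open>\<pi> * \<Sum>i. s\<^sub>i / 4\<^sup>i\<close> makes all terms with frequency in a block large and positive: modulo
  \<open>2 * \<pi>\<close>, multiplication by \<open>4 ^ i\<close> leaves \<open>\<pi> * s\<^sub>i\<close> and a small error, and the digit \<open>s\<^sub>i\<close> can be
  chosen according to the sign because \<open>i\<close> determines the block.\<close>
lemma aligned_angle:
  fixes \<epsilon> :: "nat \<Rightarrow> real"
  assumes \<epsilon>: "\<And>n. \<epsilon> n = 1 \<or> \<epsilon> n = -1"
  obtains \<theta> where "\<And>k n. n \<in> block k \<Longrightarrow> 1 / 4 \<le> \<epsilon> n * cos (real n * \<theta>)"
proof -
  define s :: "nat \<Rightarrow> nat" where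
    "s i = (if \<exists>k. i \<in> exps k \<and> \<epsilon> (4 ^ m (Suc k) + 4 ^ i) = -1 then 1 else 0)" for i
  define \<theta> where "\<theta> = pi * (\<Sum>j. real (s j) / 4 ^ j)"
  have "1 / 4 \<le> \<epsilon> n * cos (real n * \<theta>)" if n: "n \<in> block k" for k n
  proof -
    obtain i where i: "i \<in> exps k" "n = 4 ^ m (Suc k) + 4 ^ i"
      using n by (auto simp: block_def)
    have "(-1) ^ s i = \<epsilon> n"
      using \<epsilon>[of n] i by (auto simp: s_def dest: exps_unique[OF i(1)])
    moreover have "1 / 4 \<le> (-1) ^ s i * cos (real (4 ^ m (Suc k) + 4 ^ i) * \<theta>)"
      unfolding \<theta>_def by (rule four_adic_cos) (use m_Suc_notin_exps in \<open>auto simp: s_def\<close>)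
    ultimately show ?thesis by (simp add: i(2))
  qed
  then show ?thesis using that by blast
qed

text \<open>On the aligned ray, at distance comparable to \<open>1 / N\<close> from the boundary,
  the block \<open>k\<close> forces the derivative to be of order \<open>N * 2 ^ k / M\<close>,
  while the Bloch weight with its logarithm is of order at least \<open>M / N\<close>. The product
  is at least \<open>2 ^ k / 64 - 1\<close>, unbounded in \<open>k\<close>.\<close>

lemma rad_series_amp_notin_Bloch_log:
  assumes t: "\<And>n. rademacher n t = 1 \<or> rademacher n t = -1"
  shows "rad_series (\<lambda>n. complex_of_real (amp n)) t \<notin> Bloch_log"
proof
  define a where "a n = complex_of_real (amp n)" for n
  have bdd: "\<forall>n. cmod (a (Suc n)) \<le> 1"
    using amp_pos amp_le_1 by (auto simp: a_def abs_of_pos)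
  assume "rad_series (\<lambda>n. complex_of_real (amp n)) t \<in> Bloch_log"
  then obtain C where "\<forall>z\<in>ball 0 1.
      (1 - (cmod z)\<^sup>2) * cmod (deriv (rad_series a t) z) * ln (exp 1 / (1 - (cmod z)\<^sup>2)) \<le> C"
    unfolding Bloch_log_def unit_disc_def a_def[abs_def] by blast
  then have C: "(1 - (cmod z)\<^sup>2) * cmod (deriv (rad_series a t) z) * ln (exp 1 / (1 - (cmod z)\<^sup>2)) \<le> C"
    if "cmod z < 1" for z
    using that by simp
  obtain \<theta> where \<theta>: "\<And>k n. n \<in> block k \<Longrightarrow> 1 / 4 \<le> rademacher n t * cos (real n * \<theta>)"
    using aligned_angle[of "\<lambda>n. rademacher n t"] t by metis
  have "2 ^ k / 64 - 1 \<le> C" for k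
  proof -
    define M where "M = m (Suc k)"
    define N where "N = (4::real) ^ M"
    \<comment> \<open>Frequencies in the block are at most \<open>2 * N\<close>, so by Bernoulli's
      inequality the powers of this \<open>r\<close> on the block are at least 1/2.\<close>
    define r where "r = 1 - 1 / (4 * N)"
    define z where "z = complex_of_real r * cis \<theta>"
    define F where "F = rad_deriv a t z"
    have N1: "N \<ge> 1" by (simp add: N_def)
    have r: "0 < r" "r < 1" using N1 by (simp_all add: r_def field_simps)
    have cz: "cmod z = r" using r by (simp add: z_def norm_mult)
    have z1: "cmod z < 1" using r cz by simp
    define x where "x n = rademacher n t * cos (real n * \<theta>) * (real n * amp n * r ^ n)" for n
    \<comment> \<open>The minorant on the block: 1/4 from the angle, \<open>N\<close> from the
      frequency, the amplitude, and 1/2 from the power of \<open>r\<close>.\<close>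
    define y where "y n = (if n \<in> block k then 1 / 4 * (N * (2 ^ k / (real M)\<^sup>2) * (1 / 2)) else 0)" for n
    have F_sum: "(\<lambda>n. complex_of_real (rademacher (Suc n) t) * (of_nat (Suc n) * a (Suc n) * z ^ n)) sums F"
      unfolding F_def rad_deriv_def by (rule summable_sums[OF summable_rad_deriv_sign[OF bdd z1]])
    \<comment> \<open>Multiplication by \<open>z\<close> raises the exponent \<open>n\<close> back
      to the frequency \<open>Suc n\<close>, for which the angle is aligned.\<close>
    have x_sums: "(\<lambda>n. x (Suc n)) sums Re (z * F)"
    proof -
      have "(\<lambda>n. Re (z * (complex_of_real (rademacher (Suc n) t) * (of_nat (Suc n) * a (Suc n) * z ^ n)))) sums Re (z * F)"
        by (intro sums_Re sums_mult F_sum)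
      moreover have "Re (z * (complex_of_real (rademacher (Suc n) t) * (of_nat (Suc n) * a (Suc n) * z ^ n))) = x (Suc n)" for n
      proof -
        have "z * (complex_of_real (rademacher (Suc n) t) * (of_nat (Suc n) * a (Suc n) * z ^ n))
          = complex_of_real (rademacher (Suc n) t * (real (Suc n) * amp (Suc n))) * z ^ Suc n"
          by (simp add: a_def mult_ac)
        also have "z ^ Suc n = complex_of_real (r ^ Suc n) * cis (real (Suc n) * \<theta>)"
          unfolding z_def power_mult_distrib Complex.DeMoivre by simp
        finally have eq: "z * (complex_of_real (rademacher (Suc n) t) * (of_nat (Suc n) * a (Suc n) * z ^ n))
          = complex_of_real (rademacher (Suc n) t * (real (Suc n) * amp (Suc n)))
            * (complex_of_real (r ^ Suc n) * cis (real (Suc n) * \<theta>))" .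
        show ?thesis
          unfolding eq by (simp add: x_def mult_ac del: of_nat_Suc power_Suc of_real_power of_real_mult)
      qed
      ultimately show ?thesis by simp
    qed
    \<comment> \<open>Terms off all blocks are at most \<open>n / 2 ^ n\<close> in modulus, in total
      2; terms in the other blocks are nonnegative.\<close>
    have half_sums: "(\<lambda>n. real (Suc n) / 2 ^ Suc n) sums 2"
      using sums_mult[OF geometric_deriv_sums[of "1 / 2 :: real"], of "1 / 2"]
      by (simp add: power_one_over power2_eq_square mult_ac)
    have y_sums: "(\<lambda>n. y (Suc n)) sums sum y (block k)"
    proof -
      have "y sums sum y (block k)"
        by (rule sums_finite[OF finite_block]) (simp add: y_def)
      moreover have "y 0 = 0"
        using block_bounds(1)[of 0 k] by (auto simp: y_def)
      ultimately show ?thesis by (simp add: sums_Suc_iff)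
    qed
    have xy: "y (Suc n) - real (Suc n) / 2 ^ Suc n \<le> x (Suc n)" for n
    proof (cases "\<exists>l. Suc n \<in> block l")
      case True
      then obtain l where l: "Suc n \<in> block l" by blast
      have pos: "0 \<le> real (Suc n) * amp (Suc n) * r ^ Suc n"
        using amp_pos[of "Suc n"] r by simp
      have x_ge: "1 / 4 * (real (Suc n) * amp (Suc n) * r ^ Suc n) \<le> x (Suc n)"
        unfolding x_def by (intro mult_right_mono \<theta>[OF l] pos)
      have "y (Suc n) \<le> x (Suc n)"
      proof (cases "Suc n \<in> block k")
        case True
        note b = block_bounds[OF True, folded M_def]
        have n_ge: "N \<le> real (Suc n)" and n_le: "real (Suc n) \<le> 2 * N"
          using of_nat_mono[OF b(1), where 'a = real] of_nat_mono[OF b(2), where 'a = real]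
          by (simp_all add: N_def)
        have "1 / 2 \<le> 1 - real (Suc n) * (1 / (4 * N))"
          using n_le N1 by (simp add: field_simps)
        also have "\<dots> \<le> r ^ Suc n"
          using Bernoulli_inequality[of "- (1 / (4 * N))" "Suc n"] N1 by (simp add: r_def field_simps)
        finally have "1 / 2 \<le> r ^ Suc n" .
        then have "N * (2 ^ k / (real M)\<^sup>2) * (1 / 2) \<le> real (Suc n) * amp (Suc n) * r ^ Suc n"
          unfolding amp_block[OF True] M_def[symmetric] using n_ge N1 by (intro mult_mono) auto
        then show ?thesis using x_ge True by (simp add: y_def)
      next
        case False
        then show ?thesis using x_ge pos by (simp add: y_def)
      qed
      then show ?thesis
        by (smt (verit) divide_nonneg_nonneg of_nat_0_le_iff zero_le_power)
    next
      case False
      then have co: "amp (Suc n) = 1 / 2 ^ Suc n" by (intro amp_other) auto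
      have "\<bar>x (Suc n)\<bar> = \<bar>rademacher (Suc n) t * cos (real (Suc n) * \<theta>)\<bar> * (real (Suc n) / 2 ^ Suc n * r ^ Suc n)"
        unfolding x_def co using r by (simp add: abs_mult)
      also have "\<dots> \<le> 1 * (real (Suc n) / 2 ^ Suc n * 1)"
        unfolding abs_mult using r abs_rademacher_le_1[of "Suc n" t]
        by (intro mult_mono mult_le_one power_le_one) auto
      finally have "\<bar>x (Suc n)\<bar> \<le> real (Suc n) / 2 ^ Suc n" by simp
      then show ?thesis using False by (simp add: y_def del: of_nat_Suc power_Suc)
    qed
    have "sum y (block k) - 2 \<le> Re (z * F)"
      by (rule sums_le[OF xy sums_diff[OF y_sums half_sums] x_sums])
    also have "\<dots> \<le> cmod (z * F)" by (rule complex_Re_le_cmod)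
    also have "\<dots> \<le> cmod F" using r by (simp add: norm_mult cz mult_left_le_one_le)
    finally have F_ge: "sum y (block k) - 2 \<le> cmod F" .
    have M: "M > 0" using m_pos by (simp add: M_def)
    have card: "real M / 2 \<le> real (card (block k))"
      using m_Suc[of k] by (simp add: card_block M_def)
    have "N * 2 ^ k / (16 * real M) = real M / 2 * (1 / 4 * (N * (2 ^ k / (real M)\<^sup>2) * (1 / 2)))"
      using M by (simp add: power2_eq_square)
    also have "\<dots> \<le> real (card (block k)) * (1 / 4 * (N * (2 ^ k / (real M)\<^sup>2) * (1 / 2)))"
      using N1 by (intro mult_right_mono card) auto
    also have "\<dots> = sum y (block k)" by (simp add: y_def)
    finally have F_ge': "N * 2 ^ k / (16 * real M) - 2 \<le> cmod F" using F_ge by linarith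
    have w: "1 / (4 * N) \<le> 1 - r\<^sup>2" "1 - r\<^sup>2 \<le> 1 / (2 * N)"
    proof -
      have "r\<^sup>2 \<le> r" using r by (simp add: power2_eq_square mult_left_le)
      then show "1 / (4 * N) \<le> 1 - r\<^sup>2" by (simp add: r_def)
      have "1 - r\<^sup>2 \<le> 2 * (1 - r)" using zero_le_power2[of "1 - r"] by (simp add: power2_diff)
      then show "1 - r\<^sup>2 \<le> 1 / (2 * N)" by (simp add: r_def)
    qed
    have w0: "0 < 1 - r\<^sup>2" using w(1) N1 by (intro less_le_trans[OF _ w(1)]) simp
    have "real M \<le> ln (exp 1 / (1 - r\<^sup>2))"
    proof -
      have "real M * 1 \<le> real M * ln 4"
        using ln_realpow[of "2::real" 2] ln2_ge_two_thirds by (intro mult_left_mono) auto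
      also have "\<dots> = ln N" by (simp add: N_def ln_realpow)
      also have "\<dots> \<le> ln (exp 1 / (1 - r\<^sup>2))"
      proof (rule ln_mono)
        have "N * (1 - r\<^sup>2) \<le> N * (1 / (2 * N))" using w N1 by (intro mult_left_mono) auto
        also have "\<dots> \<le> exp 1" using N1 exp_ge_add_one_self[of 1] by simp
        finally show "N \<le> exp 1 / (1 - r\<^sup>2)" using w0 by (simp add: pos_le_divide_eq)
      qed (use N1 in auto)
      finally show ?thesis by simp
    qed
    then have weight: "real M / (4 * N) \<le> (1 - r\<^sup>2) * ln (exp 1 / (1 - r\<^sup>2))"
      using mult_mono[OF w(1), of "real M" "ln (exp 1 / (1 - r\<^sup>2))"] w0 by simp
    \<comment> \<open>This bounds the error 2 by 1 after multiplication with the weight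
      \<open>M / (4 * N)\<close>.\<close>
    have "real M \<le> N"
      using of_nat_mono[OF less_imp_le[OF power_gt_expt[of 4 M]], where 'a = real] by (simp add: N_def)
    then have "real M / (2 * N) \<le> 1" using N1 by (simp add: divide_le_eq)
    moreover have "(N * 2 ^ k / (16 * real M) - 2) * (real M / (4 * N)) = 2 ^ k / 64 - real M / (2 * N)"
      using N1 M by (simp add: left_diff_distrib diff_divide_distrib)
    ultimately have "2 ^ k / 64 - 1 \<le> (N * 2 ^ k / (16 * real M) - 2) * (real M / (4 * N))" by linarith
    also have "\<dots> \<le> cmod F * (real M / (4 * N))"
      using N1 by (intro mult_right_mono F_ge') auto
    also have "\<dots> \<le> cmod F * ((1 - r\<^sup>2) * ln (exp 1 / (1 - r\<^sup>2)))"
      by (intro mult_left_mono weight) auto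
    also have "\<dots> = (1 - (cmod z)\<^sup>2) * cmod (deriv (rad_series a t) z) * ln (exp 1 / (1 - (cmod z)\<^sup>2))"
      by (simp add: F_def cz deriv_rad_series[OF bdd z1])
    also have "\<dots> \<le> C" by (rule C[OF z1])
    finally show ?thesis .
  qed
  then have "2 ^ k \<le> 64 * (C + 1)" for k :: nat
    by (simp add: field_simps)
  moreover obtain k where "64 * (C + 1) < 2 ^ k"
    using real_arch_pow[of 2 "64 * (C + 1)"] by auto
  ultimately show False by (meson not_less)
qed

end

section \<open>Exceptional parameters and the choice of the exponents\<close>

text \<open>Zeros of the Rademacher functions are dyadic rationals, a countable set.\<close>

lemma AE_rademacher_eq:
  "AE t in lborel. \<forall>n. rademacher n t = 1 \<or> rademacher n t = -1"
proof -
  have "AE t in lborel. rademacher n t = 1 \<or> rademacher n t = -1" for n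
  proof -
    have "{t. sin (2 ^ (n + 1) * pi * t) = 0} \<subseteq> range (\<lambda>i::int. of_int i / 2 ^ (n + 1))"
      by (auto simp: sin_zero_iff_int2 field_simps)
    then have "countable {t. sin (2 ^ (n + 1) * pi * t) = 0}"
      by (rule countable_subset) simp
    then have "AE t in lborel. t \<notin> {t. sin (2 ^ (n + 1) * pi * t) = 0}"
      by (intro AE_not_in countable_imp_null_set_lborel)
    then show ?thesis
      by (rule AE_mp) (auto simp: rademacher_def sgn_if)
  qed
  then show ?thesis by (simp add: AE_all_countable)
qed

text \<open>Each exponent is chosen after the previous one, large enough for the gap and for
  \<open>\<delta>\<close> to have fallen below \<open>1 / 16 ^ k\<close>, which outweighs the factor
  \<open>4 ^ k\<close> from the squared amplitudes.\<close>

lemma rapid_exponents_exist: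
  fixes \<delta> :: "nat \<Rightarrow> real"
  assumes "\<delta> \<longlonglongrightarrow> 0"
  obtains m where "rapid_exponents m" "\<And>k. \<delta> (4 ^ m (Suc k)) \<le> 1 / 16 ^ k"
proof -
  have "\<exists>m. \<forall>k. 1 \<le> m k \<and> (2 * m k + 4 \<le> m (Suc k) \<and> \<delta> (4 ^ m (Suc k)) \<le> 1 / 16 ^ k)"
  proof (rule dependent_nat_choice)
    fix x k :: nat assume "1 \<le> x"
    have "eventually (\<lambda>n. \<delta> n < 1 / 16 ^ k) sequentially"
      by (rule order_tendstoD(2)[OF assms]) simp
    then obtain n0 where n0: "\<And>n. n \<ge> n0 \<Longrightarrow> \<delta> n < 1 / 16 ^ k"
      by (auto simp: eventually_sequentially)
    define y where "y = max (2 * x + 4) n0"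
    have "n0 \<le> y" by (simp add: y_def)
    also have "y \<le> 4 ^ y" by (intro less_imp_le power_gt_expt) simp
    finally have "\<delta> (4 ^ y) \<le> 1 / 16 ^ k" using n0 by (simp add: less_imp_le)
    then show "\<exists>y. 1 \<le> y \<and> 2 * x + 4 \<le> y \<and> \<delta> (4 ^ y) \<le> 1 / 16 ^ k"
      by (intro exI[of _ y]) (simp add: y_def)
  qed auto
  then show ?thesis
    using that by (metis rapid_exponents.intro)
qed

theorem theorem6:
  shows "(\<forall>a :: nat \<Rightarrow> complex.
            summable (\<lambda>n. (cmod (a (Suc n)))\<^sup>2 * (ln (real (Suc n))) ^ 3) \<longrightarrow>
            (AE t in lborel. t \<in> {0..1} \<longrightarrow> rad_series a t \<in> BMOA_log \<inter> Hinf))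
       \<and> (\<forall>\<delta> :: nat \<Rightarrow> real.
            (\<forall>n\<ge>1. 0 < \<delta> n) \<and> (\<forall>m n. 1 \<le> m \<and> m \<le> n \<longrightarrow> \<delta> n \<le> \<delta> m) \<and> \<delta> \<longlonglongrightarrow> 0 \<longrightarrow>
            (\<exists>a :: nat \<Rightarrow> real. (\<forall>n\<ge>1. 0 < a n) \<and>
               summable (\<lambda>n. (a (Suc n))\<^sup>2 * \<delta> (Suc n) * (ln (real (Suc n))) ^ 3) \<and>
               (AE t in lborel. t \<in> {0..1} \<longrightarrow>
                  rad_series (\<lambda>n. complex_of_real (a n)) t \<notin> Bloch_log)))"
proof (intro conjI allI impI)
  fix a :: "nat \<Rightarrow> complex"
  assume "summable (\<lambda>n. (cmod (a (Suc n)))\<^sup>2 * (ln (real (Suc n))) ^ 3)"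
  then show "AE t in lborel. t \<in> {0..1} \<longrightarrow> rad_series a t \<in> BMOA_log \<inter> Hinf"
    by (rule AE_rad_series_in_BMOA_log)
next
  fix \<delta> :: "nat \<Rightarrow> real"
  assume \<delta>: "(\<forall>n\<ge>1. 0 < \<delta> n) \<and> (\<forall>m n. 1 \<le> m \<and> m \<le> n \<longrightarrow> \<delta> n \<le> \<delta> m) \<and> \<delta> \<longlonglongrightarrow> 0"
  then obtain m where m: "rapid_exponents m" and small: "\<And>k. \<delta> (4 ^ m (Suc k)) \<le> 1 / 16 ^ k"
    using rapid_exponents_exist by blast
  interpret rapid_exponents m by (rule m)
  show "\<exists>a :: nat \<Rightarrow> real. (\<forall>n\<ge>1. 0 < a n) \<and>
      summable (\<lambda>n. (a (Suc n))\<^sup>2 * \<delta> (Suc n) * (ln (real (Suc n))) ^ 3) \<and>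
      (AE t in lborel. t \<in> {0..1} \<longrightarrow> rad_series (\<lambda>n. complex_of_real (a n)) t \<notin> Bloch_log)"
  proof (intro exI[of _ amp] conjI allI impI)
    show "0 < amp n" for n by (rule amp_pos)
    show "summable (\<lambda>n. (amp (Suc n))\<^sup>2 * \<delta> (Suc n) * (ln (real (Suc n))) ^ 3)"
      using \<delta> small by (intro summable_amp) auto
    show "AE t in lborel. t \<in> {0..1} \<longrightarrow> rad_series (\<lambda>n. complex_of_real (amp n)) t \<notin> Bloch_log"
      using AE_rademacher_eq by eventually_elim (simp add: rad_series_amp_notin_Bloch_log)
  qed
qed

end
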